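(* Assume that the law $P^{\xi_1}$ of the noise coordinates is log-concave with a density $p=\exp(-\phi)$, where the finite convex potential $\phi:\mathbb{R}\to\mathbb{R}$ has curvature bounded from above by a constant $c_+>0$, i.e. for all $x,y\in\mathbb{R}$ and $t\in(0,1)$, $$\phi(tx+(1-t)y)-[t\phi(x)+(1-t)\phi(y)]\ge -\frac{c_+}{2}t(1-t)(x-y)^2 .$$ Then for any $a>0$, $\alpha>0$, $1\le s\le d$, $n\ge 1$, $$\mathcal{R}^{CL}_n(\alpha,\Theta_d^+(s,a))\ \ge\ \Bigl(1-\frac{s}{d}\Bigr)\exp\Bigl(-4n(e^{\alpha/d}-1)^2\min\Bigl\{\frac{c_+a^2}{4\sigma^2},1\Bigr\}\Bigr).$$
   Context: Model: $\sigma>0$, $\theta\in\mathbb{R}^d$; $X^1,\dots,X^n$ are i.i.d. random vectors in $\mathbb{R}^d$ with law $P_\theta$, $X^i=\theta+\sigma\xi^i$, where $\xi^i$ has i.i.d. coordinates with law $P^{\xi_1}$ on $\mathbb{R}$, symmetric around $0$ and of variance $1$. $\Theta_d^+(s,a)$ is the set of $\theta\in\mathbb{R}^d$ for which there is $S\subseteq\{1,\dots,d\}$ with at most $s$ elements such that $\theta_j\ge a$ for $j\in S$ and $\theta_j=0$ for $j\notin S$. Put $\eta=(I(\theta_j\ne0))_{j=1,\dots,d}$ and, for $\hat\eta\in\{0,1\}^d$, $|\hat\eta-\eta|=\sum_{j=1}^d I(\hat\eta_j\neq\eta_j)$ (Hamming loss). A Markov kernel $Q$ is $\beta$-differentially private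 if $Q(A\mid x)\le e^{\beta}Q(A\mid x')$ for all measurable $A$ and all inputs $x,x'$. $\mathcal{Q}^{CL}_\alpha$ is the set of coordinate local mechanisms $Q=(Q^1,\dots,Q^n)$: each $Q^i$ is a product of coordinate-wise kernels, $Z^i_j\sim Q^i_j(\cdot\mid X^i_j)$ for $j=1,\dots,d$ (real-valued outputs, drawn independently over $j$ given $X^i$, and independently over $i$), where every $Q^i_j$ is $(\alpha/d)$-differentially private. The law of $(Z^1,\dots,Z^n)$ is denoted $Q(P_\theta^{\otimes n})$. A selector is a measurable map $\hat\eta=\hat\eta(Z^1,\dots,Z^n)\in\{0,1\}^d$; it is separable if for every $j$, $\hat\eta_j$ depends only on $(Z^i_j)_{i=1,\dots,n}$. $\mathcal{T}$ is the set of separable selectors. The minimax risk is $$\mathcal{R}^{CL}_n(\alpha,\Theta)=\inf_{Q\in\mathcal{Q}^{CL}_\alpha}\ \inf_{\hat\eta\in\mathcal{T}}\ \sup_{\theta\in\Theta}\ \frac1s\,\mathbb{E}_{Q(P_\theta^{\otimes n})}|\hat\eta-\eta| .$$ *)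

theory Defs
  imports "HOL-Probability.Probability"
begin

text \<open>
  A vector of \<open>\<real>\<^sup>d\<close> is an extensional function on \<open>{1..d}\<close>, and the space of vectors carries the
  product sigma-algebra; a sample of \<open>n\<close> such vectors is an extensional function on \<open>{1..n}\<close>.
\<close>

abbreviation vec_space :: "nat \<Rightarrow> (nat \<Rightarrow> real) measure" where
  "vec_space d \<equiv> PiM {1..d} (\<lambda>_. borel)"

abbreviation sample_space :: "nat \<Rightarrow> nat \<Rightarrow> (nat \<Rightarrow> nat \<Rightarrow> real) measure" where
  "sample_space n d \<equiv> PiM {1..n} (\<lambda>_. vec_space d)"

definition noise_law :: "real measure \<Rightarrow> bool" where
  "noise_law \<nu> \<longleftrightarrow> prob_space \<nu> \<and> sets \<nu> = sets borel \<and>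
     distr \<nu> borel uminus = \<nu> \<and>
     integrable \<nu> (\<lambda>x. x\<^sup>2) \<and> prob_space.variance \<nu> (\<lambda>x. x) = 1"

definition obs_law :: "real measure \<Rightarrow> real \<Rightarrow> nat \<Rightarrow> (nat \<Rightarrow> real) \<Rightarrow> (nat \<Rightarrow> real) measure" where
  "obs_law \<nu> \<sigma> d \<theta> =
     distr (PiM {1..d} (\<lambda>_. \<nu>)) (vec_space d) (\<lambda>\<xi>. \<lambda>j\<in>{1..d}. \<theta> j + \<sigma> * \<xi> j)"

definition sparse_class :: "nat \<Rightarrow> nat \<Rightarrow> real \<Rightarrow> (nat \<Rightarrow> real) set" where
  "sparse_class d s a = {\<theta> \<in> space (vec_space d).
     \<exists>S\<subseteq>{1..d}. card S \<le> s \<and> (\<forall>j\<in>S. \<theta> j \<ge> a) \<and> (\<forall>j\<in>{1..d} - S. \<theta> j = 0)}"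

definition support_vec :: "nat \<Rightarrow> (nat \<Rightarrow> real) \<Rightarrow> nat \<Rightarrow> nat" where
  "support_vec d \<theta> = (\<lambda>j\<in>{1..d}. if \<theta> j \<noteq> 0 then 1 else 0)"

definition hamming :: "nat \<Rightarrow> (nat \<Rightarrow> nat) \<Rightarrow> (nat \<Rightarrow> nat) \<Rightarrow> real" where
  "hamming d \<eta>' \<eta> = (\<Sum>j = 1..d. if \<eta>' j \<noteq> \<eta> j then 1 else 0)"

definition markov_kernel :: "(real \<Rightarrow> real measure) \<Rightarrow> bool" where
  "markov_kernel K \<longleftrightarrow> K \<in> borel \<rightarrow>\<^sub>M prob_algebra borel"

definition diff_private :: "real \<Rightarrow> (real \<Rightarrow> real measure) \<Rightarrow> bool" where
  "diff_private \<beta> K \<longleftrightarrow>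
     (\<forall>A\<in>sets borel. \<forall>x x'. measure (K x) A \<le> exp \<beta> * measure (K x') A)"

definition product_kernel ::
    "nat \<Rightarrow> (nat \<Rightarrow> real \<Rightarrow> real measure) \<Rightarrow> (nat \<Rightarrow> real) \<Rightarrow> (nat \<Rightarrow> real) measure" where
  "product_kernel d K x = PiM {1..d} (\<lambda>j. K j (x j))"

definition coord_local :: "nat \<Rightarrow> nat \<Rightarrow> real \<Rightarrow> (nat \<Rightarrow> (nat \<Rightarrow> real) \<Rightarrow> (nat \<Rightarrow> real) measure) set"
  where
  "coord_local n d \<alpha> = {Q. \<forall>i\<in>{1..n}. \<exists>K. Q i = product_kernel d K \<and>
     (\<forall>j\<in>{1..d}. markov_kernel (K j) \<and> diff_private (\<alpha> / real d) (K j))}"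

text \<open>The law \<open>Q(P\<^sup>\<otimes>\<^sup>n)\<close> of the privatized sample: draw \<open>X \<sim> P\<^sup>\<otimes>\<^sup>n\<close>, then
  \<open>Z\<^sup>i \<sim> Q\<^sup>i(\<cdot> | X\<^sup>i)\<close> independently over \<open>i\<close>.\<close>

definition private_law ::
    "nat \<Rightarrow> (nat \<Rightarrow> (nat \<Rightarrow> real) \<Rightarrow> (nat \<Rightarrow> real) measure) \<Rightarrow> (nat \<Rightarrow> real) measure
      \<Rightarrow> (nat \<Rightarrow> nat \<Rightarrow> real) measure" where
  "private_law n Q P =
     PiM {1..n} (\<lambda>_. P) \<bind> (\<lambda>x. PiM {1..n} (\<lambda>i. Q i (x i)))"

definition selectors :: "nat \<Rightarrow> nat \<Rightarrow> ((nat \<Rightarrow> nat \<Rightarrow> real) \<Rightarrow> nat \<Rightarrow> nat) set" where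
  "selectors n d = (sample_space n d \<rightarrow>\<^sub>M count_space ({1..d} \<rightarrow>\<^sub>E {0, 1}))"

definition separable_selectors :: "nat \<Rightarrow> nat \<Rightarrow> ((nat \<Rightarrow> nat \<Rightarrow> real) \<Rightarrow> nat \<Rightarrow> nat) set" where
  "separable_selectors n d = {h \<in> selectors n d.
     \<forall>j\<in>{1..d}. \<forall>z\<in>space (sample_space n d). \<forall>z'\<in>space (sample_space n d).
       (\<forall>i\<in>{1..n}. z i j = z' i j) \<longrightarrow> h z j = h z' j}"

text \<open>The risk is valued in \<open>ennreal\<close>, so that the infima and the supremum are those of a
  complete lattice.\<close>

definition minimax_risk_CL ::
    "real measure \<Rightarrow> real \<Rightarrow> nat \<Rightarrow> nat \<Rightarrow> nat \<Rightarrow> real \<Rightarrow> (nat \<Rightarrow> real) set \<Rightarrow> ennreal" where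
  "minimax_risk_CL \<nu> \<sigma> n d s \<alpha> \<Theta> =
     (INF Q\<in>coord_local n d \<alpha>. INF h\<in>separable_selectors n d. SUP \<theta>\<in>\<Theta>.
        ennreal (1 / real s) *
        (\<integral>\<^sup>+ z. ennreal (hamming d (h z) (support_vec d \<theta>))
           \<partial>private_law n Q (obs_law \<nu> \<sigma> d \<theta>)))"

end

theory Submission
  imports Defs
begin

text \<open>
  A separable selector at coordinate \<open>j\<close> sees only the \<open>j\<close>-th privatized column, whose law is a product
  depending only on \<open>\<theta> j\<close>. Averaging over supports of size \<open>s\<close> (here: choosing the \<open>s\<close> coordinates
  where missing a signal costs most) therefore reduces the risk to \<open>d\<close> Bayesian tests between
  \<open>\<theta> j = a\<close>, with prior weight \<open>\<pi> = s / d\<close>, and \<open>\<theta> j = 0\<close>. If \<open>L\<close> is the likelihood ratio of the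
  null law with respect to the alternative \<open>F\<close> and \<open>\<integral> L\<^sup>2 dF \<le> V\<close>, the Bayes error is at least
  \<open>\<pi> (1 - \<pi>) / V\<close>, by convexity of \<open>u \<mapsto> 1 / u\<close>. A \<open>\<beta>\<close>-private kernel contracts: on every event
  the two output laws differ by at most \<open>\<tau> = (exp \<beta> - 1) TV\<close> times the mass under either of them,
  so \<open>V = (1 + \<tau>\<^sup>2)\<^sup>n \<le> exp (n \<tau>\<^sup>2)\<close>. Finally \<open>TV\<^sup>2 \<le> 1 - \<rho>\<^sup>2\<close> for the Hellinger affinity \<open>\<rho>\<close>, and
  the curvature bound at the midpoint of \<open>x\<close> and \<open>x - h\<close>, \<open>h = a / \<sigma>\<close>, gives \<open>\<rho> \<ge> exp (- c h\<^sup>2 / 8)\<close>.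
\<close>

section \<open>Choosing a least favourable support\<close>

text \<open>Downward induction from \<open>T\<close> itself: removing an element with the least
  value of \<open>c\<close> cannot lower the average over the remaining ones. It replaces a random
  support of size \<open>s\<close> by a deterministic one that does at least as well on
  average.\<close>

lemma exists_subset_sum_ge_average:
  fixes c :: "'a \<Rightarrow> real"
  assumes "finite T" "s \<le> card T"
  shows "\<exists>S\<subseteq>T. card S = s \<and> real s * sum c T \<le> real (card T) * sum c S"
  using assms
proof (induction "card T - s" arbitrary: s)
  case 0
  then show ?case by (intro exI[of _ T]) auto
next
  case (Suc k)
  then have "Suc s \<le> card T" "k = card T - Suc s" by auto
  from Suc.hyps(1)[OF this(2) Suc.prems(1) this(1)] obtain S where S: "S \<subseteq> T" "card S = Suc s"
    "real (Suc s) * sum c T \<le> real (card T) * sum c S" by blast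
  then have "S \<noteq> {}" "finite S"
    using finite_subset[OF S(1) Suc.prems(1)] by auto
  define x where "x = arg_min_on c S"
  have x: "x \<in> S" "\<And>y. y \<in> S \<Longrightarrow> c x \<le> c y"
    unfolding x_def using \<open>S \<noteq> {}\<close> \<open>finite S\<close> by (auto intro: arg_min_least arg_min_if_finite)
  have split: "sum c S = c x + sum c (S - {x})"
    using x(1) \<open>finite S\<close> by (simp add: sum.remove)
  have card: "card (S - {x}) = s"
    using x(1) S(2) \<open>finite S\<close> by simp
  have "real s * c x \<le> sum c (S - {x})"
    using sum_bounded_below[of "S - {x}" "c x" c] x(2) card by simp
  then have "real s * sum c S \<le> real (Suc s) * sum c (S - {x})"
    by (simp add: split algebra_simps)
  then have "real s * (real (card T) * sum c S) \<le> real (card T) * (real (Suc s) * sum c (S - {x}))"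
    by (metis mult.left_commute mult_left_mono of_nat_0_le_iff)
  moreover have "real s * (real (Suc s) * sum c T) \<le> real s * (real (card T) * sum c S)"
    using S(3) by (intro mult_left_mono) auto
  ultimately have "real s * (real (Suc s) * sum c T) \<le> real (card T) * (real (Suc s) * sum c (S - {x}))"
    by (rule order_trans[rotated])
  then have "real (Suc s) * (real s * sum c T) \<le> real (Suc s) * (real (card T) * sum c (S - {x}))"
    by (simp only: mult.left_commute)
  then have "real s * sum c T \<le> real (card T) * sum c (S - {x})"
    by (subst (asm) mult_le_cancel_left_pos) auto
  then show ?case
    using card S(1) by (intro exI[of _ "S - {x}"]) auto
qed

section \<open>Bayes error of a binary test from the second moment of the likelihood ratio\<close>

text \<open>The tangent line to \<open>u \<mapsto> 1 / u\<close> at \<open>V\<close>, applied to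
  \<open>min x y \<ge> x y / (x + y)\<close> with \<open>x = \<pi>\<close> and \<open>y = (1 - \<pi>) L\<close>.\<close>

lemma min_ge_quadratic:
  fixes \<pi> V L :: real
  assumes "0 \<le> \<pi>" "\<pi> \<le> 1" "0 < V" "0 \<le> L"
  shows "\<pi> * (1 - \<pi>) * (2 / V * L - (\<pi> * L + (1 - \<pi>) * L\<^sup>2) / V\<^sup>2) \<le> min \<pi> ((1 - \<pi>) * L)"
proof -
  define m where "m = \<pi> + (1 - \<pi>) * L"
  have hm: "\<pi> * (1 - \<pi>) * L \<le> m * min \<pi> ((1 - \<pi>) * L)"
  proof -
    have "x * y \<le> (x + y) * min x y" if "0 \<le> x" "0 \<le> y" for x y :: real
      using that by (auto simp: min_def algebra_simps)
    from this[of \<pi> "(1 - \<pi>) * L"] show "\<pi> * (1 - \<pi>) * L \<le> m * min \<pi> ((1 - \<pi>) * L)"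
      using assms by (simp add: m_def mult.assoc)
  qed
  have sq: "m * (2 / V - m / V\<^sup>2) \<le> 1"
  proof -
    have "0 \<le> (1 - m / V)\<^sup>2" by simp
    also have "\<dots> = 1 - m * (2 / V - m / V\<^sup>2)"
      by (simp add: power2_eq_square algebra_simps add_divide_distrib)
    finally show ?thesis by simp
  qed
  have mn: "0 \<le> min \<pi> ((1 - \<pi>) * L)" using assms by simp
  have eq: "\<pi> * (1 - \<pi>) * (2 / V * L - (\<pi> * L + (1 - \<pi>) * L\<^sup>2) / V\<^sup>2)
      = (\<pi> * (1 - \<pi>) * L) * (2 / V - m / V\<^sup>2)"
    using assms(3) by (simp add: m_def power2_eq_square field_simps)
  show ?thesis
  \<comment> \<open>\<open>hm\<close> can be multiplied by the tangent value only while that is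
    nonnegative. Where the tangent line has dropped below zero, the left-hand side is nonpositive
    and the claim is trivial.\<close>
  proof (cases "0 \<le> 2 / V - m / V\<^sup>2")
    case True
    have "(\<pi> * (1 - \<pi>) * L) * (2 / V - m / V\<^sup>2) \<le> (m * min \<pi> ((1 - \<pi>) * L)) * (2 / V - m / V\<^sup>2)"
      by (rule mult_right_mono[OF hm True])
    also have "\<dots> = (m * (2 / V - m / V\<^sup>2)) * min \<pi> ((1 - \<pi>) * L)"
      by simp
    also have "\<dots> \<le> 1 * min \<pi> ((1 - \<pi>) * L)"
      by (rule mult_right_mono[OF sq mn])
    finally show ?thesis unfolding eq by simp
  next
    case False
    have "(\<pi> * (1 - \<pi>) * L) * (2 / V - m / V\<^sup>2) \<le> 0"
      using False assms by (intro mult_nonneg_nonpos) auto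
    then show ?thesis using mn unfolding eq by linarith
  qed
qed

text \<open>At each point either decision costs at least
  \<open>min \<pi> ((1 - \<pi>) * L x)\<close>, whatever the region \<open>A\<close> in which a
  signal is declared. The quadratic minorant of this minimum integrates explicitly, since
  \<open>L\<close> has mean one and second moment at most \<open>V\<close>.\<close>

lemma bayes_error_ge_second_moment:
  fixes L :: "'a \<Rightarrow> real"
  assumes "prob_space F" and L[measurable]: "L \<in> borel_measurable F" and L0: "\<And>x. 0 \<le> L x"
    and "prob_space (density F (\<lambda>x. ennreal (L x)))"
    and V: "(\<integral>\<^sup>+x. ennreal ((L x)\<^sup>2) \<partial>F) \<le> ennreal V" "1 \<le> V"
    and \<pi>: "0 \<le> \<pi>" "\<pi> \<le> 1" and A[measurable]: "A \<in> sets F"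
  shows "\<pi> * (1 - \<pi>) / V
    \<le> \<pi> * measure F (space F - A) + (1 - \<pi>) * measure (density F (\<lambda>x. ennreal (L x))) A"
proof -
  interpret F: prob_space F by fact
  interpret G: prob_space "density F (\<lambda>x. ennreal (L x))" by fact
  have one: "(\<integral>\<^sup>+x. ennreal (L x) \<partial>F) = 1"
    using G.emeasure_space_1 by (simp add: emeasure_density cong: nn_integral_cong)
  have iL: "integrable F L"
    using L0 one by (intro integrableI_bounded) auto
  have intL: "(\<integral>x. L x \<partial>F) = 1"
    using L0 one iL by (subst integral_eq_nn_integral) auto
  have iL2: "integrable F (\<lambda>x. (L x)\<^sup>2)"
    using V by (intro integrableI_bounded) (auto intro: le_less_trans)
  have intL2: "(\<integral>x. (L x)\<^sup>2 \<partial>F) \<le> V"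
    using V by (subst integral_eq_nn_integral) (auto simp: enn2real_leI)
  have iLA: "integrable F (\<lambda>x. L x * indicator A x)"
    using iL by (rule Bochner_Integration.integrable_bound) (auto simp: indicator_def)
  have GA: "measure (density F (\<lambda>x. ennreal (L x))) A = (\<integral>x. L x * indicator A x \<partial>F)"
  proof -
    have "emeasure (density F (\<lambda>x. ennreal (L x))) A = (\<integral>\<^sup>+x. ennreal (L x * indicator A x) \<partial>F)"
      using L0 by (simp add: emeasure_density ennreal_mult ennreal_indicator)
    also have "\<dots> = ennreal (\<integral>x. L x * indicator A x \<partial>F)"
      using L0 iLA by (intro nn_integral_eq_integral) auto
    finally show ?thesis using L0 by (simp add: measure_def)
  qed
  have iI: "integrable F (\<lambda>x. indicator (space F - A) x :: real)"
    by (rule integrable_real_indicator) (auto simp: F.emeasure_eq_measure)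
  have FA: "measure F (space F - A) = (\<integral>x. indicator (space F - A) x \<partial>F)"
    by simp
  \<comment> \<open>The mixture \<open>\<pi> + (1 - \<pi>) * V\<close> is at most \<open>V\<close>
    because \<open>1 \<le> V\<close>, so the tangent at \<open>V\<close> still yields
    \<open>1 / V\<close>.\<close>
  have "\<pi> * (1 - \<pi>) / V \<le> \<pi> * (1 - \<pi>) * (2 / V - (\<pi> + (1 - \<pi>) * V) / V\<^sup>2)"
  proof -
    have "\<pi> + (1 - \<pi>) * V \<le> V"
      using V(2) \<pi> mult_left_mono[of 1 V \<pi>] by (simp add: algebra_simps)
    then have "(\<pi> + (1 - \<pi>) * V) / V\<^sup>2 \<le> V / V\<^sup>2"
      by (intro divide_right_mono) auto
    also have "\<dots> = 1 / V" using V(2) by (simp add: power2_eq_square)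
    finally have "1 / V \<le> 2 / V - (\<pi> + (1 - \<pi>) * V) / V\<^sup>2"
      by simp
    then show ?thesis
      using mult_left_mono[of "1 / V" "2 / V - (\<pi> + (1 - \<pi>) * V) / V\<^sup>2" "\<pi> * (1 - \<pi>)"] \<pi> by simp
  qed
  also have "\<dots> \<le> \<pi> * (1 - \<pi>) * (2 / V * 1 - (\<pi> * 1 + (1 - \<pi>) * (\<integral>x. (L x)\<^sup>2 \<partial>F)) / V\<^sup>2)"
    using \<pi> intL2 V(2)
    by (intro mult_left_mono diff_mono divide_right_mono add_mono) auto
  also have "\<dots> = (\<integral>x. \<pi> * (1 - \<pi>) * (2 / V * L x - (\<pi> * L x + (1 - \<pi>) * (L x)\<^sup>2) / V\<^sup>2) \<partial>F)"
    using iL iL2 by (simp add: intL)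
  also have "\<dots> \<le> (\<integral>x. \<pi> * indicator (space F - A) x + (1 - \<pi>) * (L x * indicator A x) \<partial>F)"
  proof (rule integral_mono)
    show "integrable F (\<lambda>x. \<pi> * (1 - \<pi>) * (2 / V * L x - (\<pi> * L x + (1 - \<pi>) * (L x)\<^sup>2) / V\<^sup>2))"
      using iL iL2 by simp
    show "integrable F (\<lambda>x. \<pi> * indicator (space F - A) x + (1 - \<pi>) * (L x * indicator A x))"
      by (intro Bochner_Integration.integrable_add integrable_mult_right iLA iI)
    fix x assume "x \<in> space F"
    then have "min \<pi> ((1 - \<pi>) * L x) \<le> \<pi> * indicator (space F - A) x + (1 - \<pi>) * (L x * indicator A x)"
      by (auto simp: indicator_def)
    with min_ge_quadratic[OF \<pi>, of V "L x"] V(2) L0[of x]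
    show "\<pi> * (1 - \<pi>) * (2 / V * L x - (\<pi> * L x + (1 - \<pi>) * (L x)\<^sup>2) / V\<^sup>2)
        \<le> \<pi> * indicator (space F - A) x + (1 - \<pi>) * (L x * indicator A x)"
      by linarith
  qed
  also have "\<dots> = \<pi> * measure F (space F - A) + (1 - \<pi>) * measure (density F (\<lambda>x. ennreal (L x))) A"
    unfolding GA FA using iLA iI by simp
  finally show ?thesis .
qed

section \<open>Likelihood ratios of laws that are close on every event\<close>

text \<open>Tested on the set where \<open>f\<close> is positive, the hypothesis forces an integral
  of a nonnegative function to vanish. This turns inequalities between probabilities of events into
  pointwise bounds on a density.\<close>

lemma AE_le_of_set_integral_le:
  fixes f :: "'a \<Rightarrow> real"
  assumes f: "integrable M f"
    and le: "\<And>A. A \<in> sets M \<Longrightarrow> (\<integral>x. f x * indicator A x \<partial>M) \<le> 0"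
  shows "AE x in M. f x \<le> 0"
proof -
  have [measurable]: "f \<in> borel_measurable M" using f by auto
  define A where "A = {x \<in> space M. 0 < f x}"
  have [measurable]: "A \<in> sets M" unfolding A_def by measurable
  have i: "integrable M (\<lambda>x. f x * indicator A x)"
    using f by (rule Bochner_Integration.integrable_bound) (auto simp: indicator_def)
  have nn: "AE x in M. 0 \<le> f x * indicator A x"
    by (auto simp: A_def indicator_def)
  have "(\<integral>x. f x * indicator A x \<partial>M) = 0"
    using le[of A] integral_nonneg_AE[OF nn] by auto
  then have "AE x in M. f x * indicator A x = 0"
    using integral_nonneg_eq_0_iff_AE[OF i nn] by simp
  then show ?thesis
    using AE_space by eventually_elim (auto simp: A_def indicator_def split: if_splits)
qed

text \<open>A relative bound on all events gives absolute continuity, since null events of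
  \<open>F\<close> are null for \<open>G\<close>, and it confines the density \<open>L\<close> to
  the interval from \<open>1 - \<tau>\<close> to \<open>1 + \<tau>\<close> almost everywhere. As
  \<open>L\<close> has mean one, its second moment exceeds 1 by its variance, which is at most
  \<open>\<tau>\<^sup>2\<close>.\<close>

lemma density_second_moment_le:
  assumes "prob_space F" "prob_space G" and sets: "sets G = sets F" and \<tau>: "0 \<le> \<tau>"
    and le: "\<And>A. A \<in> sets F \<Longrightarrow> \<bar>measure G A - measure F A\<bar> \<le> \<tau> * measure F A"
  obtains L where "L \<in> borel_measurable F" "\<And>x. 0 \<le> L x" "G = density F (\<lambda>x. ennreal (L x))"
    "(\<integral>\<^sup>+x. ennreal ((L x)\<^sup>2) \<partial>F) \<le> ennreal (1 + \<tau>\<^sup>2)"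
proof -
  interpret F: prob_space F by fact
  interpret G: prob_space G by fact
  have ac: "absolutely_continuous F G"
    unfolding absolutely_continuous_def
  proof
    fix N assume N: "N \<in> null_sets F"
    then have "measure F N = 0" "N \<in> sets F" by (auto simp: measure_eq_0_null_sets)
    with le[of N] have "measure G N = 0" by (simp add: measure_le_0_iff)
    with \<open>N \<in> sets F\<close> show "N \<in> null_sets G"
      using sets by (simp add: null_sets_def G.emeasure_eq_measure)
  qed
  obtain L where L: "L \<in> borel_measurable F" "AE x in F. RN_deriv F G x = ennreal (L x)" "\<And>x. 0 \<le> L x"
    by (rule F.real_RN_deriv[OF G.finite_measure_axioms ac sets]) blast
  note [measurable] = L(1)
  have G: "G = density F (\<lambda>x. ennreal (L x))"
    using F.density_RN_deriv[OF ac sets] density_cong[OF _ _ L(2)] by simp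
  have one: "(\<integral>\<^sup>+x. ennreal (L x) \<partial>F) = 1"
    using G.emeasure_space_1 unfolding G by (simp add: emeasure_density cong: nn_integral_cong)
  have iL: "integrable F L"
    using L(3) one by (intro integrableI_bounded) auto
  have intL: "(\<integral>x. L x \<partial>F) = 1"
    using L(3) one iL by (subst integral_eq_nn_integral) auto
  have iLA: "integrable F (\<lambda>x. L x * indicator A x)" if [measurable]: "A \<in> sets F" for A
    using iL by (rule Bochner_Integration.integrable_bound) (auto simp: indicator_def)
  have GA: "measure G A = (\<integral>x. L x * indicator A x \<partial>F)" if [measurable]: "A \<in> sets F" for A
  proof -
    have "emeasure G A = (\<integral>\<^sup>+x. ennreal (L x * indicator A x) \<partial>F)"
      using L(3) unfolding G by (simp add: emeasure_density ennreal_mult ennreal_indicator)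
    also have "\<dots> = ennreal (\<integral>x. L x * indicator A x \<partial>F)"
      using L(3) iLA[OF that] by (intro nn_integral_eq_integral) auto
    finally show ?thesis using L(3) by (simp add: measure_def)
  qed
  have iI: "integrable F (\<lambda>x. indicator A x :: real)" if "A \<in> sets F" for A
    using that by (intro integrable_real_indicator) (auto simp: F.emeasure_eq_measure)
  have "AE x in F. L x - (1 + \<tau>) \<le> 0"
  proof (rule AE_le_of_set_integral_le)
    fix A assume A[measurable]: "A \<in> sets F"
    have "(\<integral>x. (L x - (1 + \<tau>)) * indicator A x \<partial>F) = measure G A - (1 + \<tau>) * measure F A"
      using iLA[OF A] iI[OF A] by (simp add: GA[OF A] left_diff_distrib)
    also have "\<dots> \<le> 0" using le[OF A] by (simp add: algebra_simps abs_le_iff)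
    finally show "(\<integral>x. (L x - (1 + \<tau>)) * indicator A x \<partial>F) \<le> 0" .
  qed (use iL in simp)
  moreover have "AE x in F. (1 - \<tau>) - L x \<le> 0"
  proof (rule AE_le_of_set_integral_le)
    fix A assume A[measurable]: "A \<in> sets F"
    have "(\<integral>x. ((1 - \<tau>) - L x) * indicator A x \<partial>F) = (1 - \<tau>) * measure F A - measure G A"
      using iLA[OF A] iI[OF A] by (simp add: GA[OF A] left_diff_distrib)
    also have "\<dots> \<le> 0" using le[OF A] by (simp add: algebra_simps abs_le_iff)
    finally show "(\<integral>x. ((1 - \<tau>) - L x) * indicator A x \<partial>F) \<le> 0" .
  qed (use iL in simp)
  \<comment> \<open>Expanding the square leaves a majorant affine in \<open>L\<close>, whose
    integral is known exactly from the mean.\<close>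
  ultimately have bound: "AE x in F. (L x)\<^sup>2 \<le> 2 * L x - 1 + \<tau>\<^sup>2"
  proof eventually_elim
    case (elim x)
    then have "\<bar>L x - 1\<bar> \<le> \<tau>" by (simp add: abs_le_iff)
    then have "(L x - 1)\<^sup>2 \<le> \<tau>\<^sup>2" by (metis abs_ge_zero power2_abs power_mono)
    then show ?case by (simp add: power2_eq_square algebra_simps)
  qed
  then have nn: "AE x in F. 0 \<le> 2 * L x - 1 + \<tau>\<^sup>2"
    by eventually_elim (meson order_trans zero_le_power2)
  have "(\<integral>\<^sup>+x. ennreal ((L x)\<^sup>2) \<partial>F) \<le> (\<integral>\<^sup>+x. ennreal (2 * L x - 1 + \<tau>\<^sup>2) \<partial>F)"
    using bound by (intro nn_integral_mono_AE) (auto intro: ennreal_leI)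
  also have "\<dots> = ennreal (\<integral>x. 2 * L x - 1 + \<tau>\<^sup>2 \<partial>F)"
    using iL nn by (intro nn_integral_eq_integral) auto
  also have "(\<integral>x. 2 * L x - 1 + \<tau>\<^sup>2 \<partial>F) = 1 + \<tau>\<^sup>2"
    using iL by (simp add: intL F.prob_space)
  finally show ?thesis using that[OF L(1) L(3) G] by blast
qed

section \<open>Finite products of probability measures and of densities\<close>

lemma emeasure_PiM_PiE:
  assumes "finite I" "\<And>i. i \<in> I \<Longrightarrow> prob_space (M i)" "\<And>i. i \<in> I \<Longrightarrow> A i \<in> sets (M i)"
  shows "emeasure (PiM I M) (Pi\<^sub>E I A) = (\<Prod>i\<in>I. emeasure (M i) (A i))"
proof -
  have "prod_emb I M I (Pi\<^sub>E I A) = Pi\<^sub>E I A"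
    using assms(3)[THEN sets.sets_into_space] by simp
  then show ?thesis
    using emeasure_PiM_emb[of I M I A] assms by simp
qed

lemma nn_integral_PiM_prod:
  fixes f :: "'i \<Rightarrow> 'a \<Rightarrow> ennreal"
  assumes I: "finite I" and M: "\<And>i. i \<in> I \<Longrightarrow> prob_space (M i)"
    and f: "\<And>i. i \<in> I \<Longrightarrow> f i \<in> borel_measurable (M i)"
  shows "(\<integral>\<^sup>+x. (\<Prod>i\<in>I. f i (x i)) \<partial>PiM I M) = (\<Prod>i\<in>I. \<integral>\<^sup>+x. f i x \<partial>M i)"
proof -
  \<comment> \<open>The locale \<open>product_sigma_finite\<close> asks for a sigma-finite measure
    at every index; those outside \<open>I\<close> get a point mass, which leaves the product over
    \<open>I\<close> unchanged.\<close>
  define N where "N = (\<lambda>i. if i \<in> I then M i else return (count_space UNIV) undefined)"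
  have "prob_space (N i)" for i
    using M by (auto simp: N_def intro: prob_space_return)
  then interpret product_sigma_finite N
    by (simp add: product_sigma_finite_def prob_space_imp_sigma_finite)
  have "PiM I M = PiM I N" by (intro PiM_cong) (auto simp: N_def)
  then show ?thesis
    using product_nn_integral_prod[OF I, of f] f by (simp add: N_def)
qed

lemma PiM_eqI_prob_space:
  assumes I: "finite I" and M: "\<And>i. i \<in> I \<Longrightarrow> prob_space (M i)" and P: "sets P = sets (PiM I M)"
    and eq: "\<And>A. (\<And>i. i \<in> I \<Longrightarrow> A i \<in> sets (M i)) \<Longrightarrow>
      emeasure P (Pi\<^sub>E I A) = (\<Prod>i\<in>I. emeasure (M i) (A i))"
  shows "P = PiM I M"
proof -
  define N where "N = (\<lambda>i. if i \<in> I then M i else return (count_space UNIV) undefined)"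
  have "prob_space (N i)" for i
    using M by (auto simp: N_def intro: prob_space_return)
  then interpret product_sigma_finite N
    by (simp add: product_sigma_finite_def prob_space_imp_sigma_finite)
  have MN: "PiM I M = PiM I N" by (intro PiM_cong) (auto simp: N_def)
  show ?thesis unfolding MN
  proof (rule PiM_eqI[OF I])
    show "sets P = sets (PiM I N)" using P by (simp add: MN)
    show "emeasure P (Pi\<^sub>E I A) = (\<Prod>i\<in>I. emeasure (N i) (A i))"
      if "\<And>i. i \<in> I \<Longrightarrow> A i \<in> sets (N i)" for A
      using eq[of A] that by (simp add: N_def)
  qed
qed

text \<open>It suffices to compare both measures on boxes. There the indicator splits into
  coordinate indicators, so the integral of the product density factorizes.\<close>

lemma PiM_density:
  assumes I: "finite I" and F: "\<And>i. i \<in> I \<Longrightarrow> prob_space (F i)"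
    and G: "\<And>i. i \<in> I \<Longrightarrow> prob_space (density (F i) (L i))"
    and L: "\<And>i. i \<in> I \<Longrightarrow> L i \<in> borel_measurable (F i)"
  shows "density (PiM I F) (\<lambda>x. \<Prod>i\<in>I. L i (x i)) = PiM I (\<lambda>i. density (F i) (L i))"
proof (rule PiM_eqI_prob_space[OF I G])
  show "sets (density (PiM I F) (\<lambda>x. \<Prod>i\<in>I. L i (x i))) = sets (PiM I (\<lambda>i. density (F i) (L i)))"
    by (simp cong: sets_PiM_cong)
  fix A assume A: "\<And>i. i \<in> I \<Longrightarrow> A i \<in> sets (density (F i) (L i))"
  then have A': "\<And>i. i \<in> I \<Longrightarrow> A i \<in> sets (F i)" by simp
  note [measurable] = L
  have [measurable]: "(\<lambda>x. \<Prod>i\<in>I. L i (x i)) \<in> borel_measurable (PiM I F)"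
    by measurable
  have PiE_A: "Pi\<^sub>E I A \<in> sets (PiM I F)" using I A' by auto
  \<comment> \<open>Points of the space are extensional, so one outside the box must leave some
    \<open>A i\<close> with \<open>i\<close> in \<open>I\<close>, and that factor annihilates the
    product.\<close>
  have ind: "(\<Prod>i\<in>I. L i (x i)) * indicator (Pi\<^sub>E I A) x = (\<Prod>i\<in>I. L i (x i) * indicator (A i) (x i))"
    if x: "x \<in> space (PiM I F)" for x
  proof (cases "x \<in> Pi\<^sub>E I A")
    case True
    then have "indicator (A i) (x i) = (1::ennreal)" if "i \<in> I" for i
      using that by (auto simp: PiE_iff)
    then show ?thesis using True by (simp cong: prod.cong)
  next
    case False
    then obtain i where "i \<in> I" "x i \<notin> A i"
      using x by (auto simp: space_PiM PiE_iff)
    then have "(\<Prod>i\<in>I. L i (x i) * indicator (A i) (x i)) = 0"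
      using I by (intro prod_zero bexI[of _ i]) (auto simp: indicator_def)
    then show ?thesis using False by simp
  qed
  have "emeasure (density (PiM I F) (\<lambda>x. \<Prod>i\<in>I. L i (x i))) (Pi\<^sub>E I A)
      = (\<integral>\<^sup>+x. (\<Prod>i\<in>I. L i (x i) * indicator (A i) (x i)) \<partial>PiM I F)"
    using PiE_A by (simp add: emeasure_density ind cong: nn_integral_cong)
  also have "\<dots> = (\<Prod>i\<in>I. \<integral>\<^sup>+x. L i x * indicator (A i) x \<partial>F i)"
    by (rule nn_integral_PiM_prod[OF I F]) (use L A' in auto)
  also have "\<dots> = (\<Prod>i\<in>I. emeasure (density (F i) (L i)) (A i))"
    using L A' by (intro prod.cong) (auto simp: emeasure_density)
  finally show "emeasure (density (PiM I F) (\<lambda>x. \<Prod>i\<in>I. L i (x i))) (Pi\<^sub>E I A)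
      = (\<Prod>i\<in>I. emeasure (density (F i) (L i)) (A i))" .
qed

text \<open>Unlike total variation, the second moment of the likelihood ratio is multiplicative: the
  ratio of the products is the product of the ratios. Hence the bounds for single observations are
  simply multiplied.\<close>

lemma density_product_second_moment_le:
  assumes I: "finite I" and F: "\<And>i. i \<in> I \<Longrightarrow> prob_space (F i)" and G: "\<And>i. i \<in> I \<Longrightarrow> prob_space (G i)"
    and sets: "\<And>i. i \<in> I \<Longrightarrow> sets (G i) = sets (F i)" and \<tau>: "0 \<le> \<tau>"
    and le: "\<And>i A. i \<in> I \<Longrightarrow> A \<in> sets (F i) \<Longrightarrow>
      \<bar>measure (G i) A - measure (F i) A\<bar> \<le> \<tau> * measure (F i) A"
  obtains L where "L \<in> borel_measurable (PiM I F)" "\<And>x. 0 \<le> L x"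
    "PiM I G = density (PiM I F) (\<lambda>x. ennreal (L x))"
    "(\<integral>\<^sup>+x. ennreal ((L x)\<^sup>2) \<partial>PiM I F) \<le> ennreal ((1 + \<tau>\<^sup>2) ^ card I)"
proof -
  have "\<exists>L. L \<in> borel_measurable (F i) \<and> (\<forall>x. 0 \<le> L x) \<and> G i = density (F i) (\<lambda>x. ennreal (L x))
      \<and> (\<integral>\<^sup>+x. ennreal ((L x)\<^sup>2) \<partial>F i) \<le> ennreal (1 + \<tau>\<^sup>2)" if "i \<in> I" for i
    using density_second_moment_le[OF F[OF that] G[OF that] sets[OF that] \<tau> le[OF that]] by metis
  then obtain L where L: "\<And>i. i \<in> I \<Longrightarrow> L i \<in> borel_measurable (F i)"
      "\<And>i x. i \<in> I \<Longrightarrow> 0 \<le> L i x"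
      "\<And>i. i \<in> I \<Longrightarrow> G i = density (F i) (\<lambda>x. ennreal (L i x))"
      "\<And>i. i \<in> I \<Longrightarrow> (\<integral>\<^sup>+x. ennreal ((L i x)\<^sup>2) \<partial>F i) \<le> ennreal (1 + \<tau>\<^sup>2)"
    by metis
  note [measurable] = L(1)
  define P where "P = (\<lambda>x. \<Prod>i\<in>I. L i (x i))"
  have P[measurable]: "P \<in> borel_measurable (PiM I F)"
    unfolding P_def by measurable
  have P0: "0 \<le> P x" for x
    unfolding P_def using L(2) by (intro prod_nonneg) auto
  have "PiM I G = PiM I (\<lambda>i. density (F i) (\<lambda>x. ennreal (L i x)))"
    using L(3) by (intro PiM_cong) auto
  also have "\<dots> = density (PiM I F) (\<lambda>x. \<Prod>i\<in>I. ennreal (L i (x i)))"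
    using G L(3) by (intro PiM_density[OF I F, symmetric]) (auto simp: L(1) measurable_compose)
  also have "(\<lambda>x. \<Prod>i\<in>I. ennreal (L i (x i))) = (\<lambda>x. ennreal (P x))"
    unfolding P_def using L(2) by (intro ext prod_ennreal) auto
  finally have dens: "PiM I G = density (PiM I F) (\<lambda>x. ennreal (P x))" .
  have "(\<integral>\<^sup>+x. ennreal ((P x)\<^sup>2) \<partial>PiM I F) = (\<integral>\<^sup>+x. (\<Prod>i\<in>I. ennreal ((L i (x i))\<^sup>2)) \<partial>PiM I F)"
    unfolding P_def by (simp add: prod_ennreal prod_power_distrib)
  also have "\<dots> = (\<Prod>i\<in>I. \<integral>\<^sup>+x. ennreal ((L i x)\<^sup>2) \<partial>F i)"
    by (rule nn_integral_PiM_prod[OF I F]) auto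
  also have "\<dots> \<le> (\<Prod>i\<in>I. ennreal (1 + \<tau>\<^sup>2))"
    by (intro prod_mono_ennreal L(4))
  also have "\<dots> = ennreal ((1 + \<tau>\<^sup>2) ^ card I)"
    by (subst ennreal_power[symmetric]) (simp_all flip: ennreal_plus)
  finally show ?thesis using that[OF P P0 dens] by blast
qed

section \<open>Total variation, Hellinger affinity and translations of the noise\<close>

text \<open>This is Cauchy-Schwarz for \<open>\<bar>p - q\<bar> = \<bar>sqrt p - sqrt q\<bar> *
  (sqrt p + sqrt q)\<close>. With \<rho> the affinity, the squares of the two factors integrate to
  \<open>2 - 2 * \<rho>\<close> and \<open>2 + 2 * \<rho>\<close>.\<close>

lemma abs_diff_integral_sq_le:
  fixes p q :: "'a \<Rightarrow> real"
  assumes p: "integrable M p" and q: "integrable M q"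
    and p0: "\<And>x. 0 \<le> p x" and q0: "\<And>x. 0 \<le> q x"
    and p1: "(\<integral>x. p x \<partial>M) = 1" and q1: "(\<integral>x. q x \<partial>M) = 1"
  shows "((\<integral>x. \<bar>p x - q x\<bar> \<partial>M) / 2)\<^sup>2 \<le> 1 - (\<integral>x. sqrt (p x * q x) \<partial>M)\<^sup>2"
proof -
  have [measurable]: "p \<in> borel_measurable M" "q \<in> borel_measurable M" using p q by auto
  have am: "sqrt (p x * q x) \<le> (p x + q x) / 2" for x
    by (rule arith_geo_mean_sqrt[OF p0 q0])
  have ir: "integrable M (\<lambda>x. sqrt (p x * q x))"
  proof (rule Bochner_Integration.integrable_bound)
    show "integrable M (\<lambda>x. (p x + q x) / 2)" using p q by simp
    have "norm (sqrt (p x * q x)) \<le> norm ((p x + q x) / 2)" for x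
      using am[of x] p0[of x] q0[of x] by simp
    then show "AE x in M. norm (sqrt (p x * q x)) \<le> norm ((p x + q x) / 2)" by simp
  qed measurable
  have ia: "integrable M (\<lambda>x. \<bar>p x - q x\<bar>)"
    using p q by simp
  define \<rho> where "\<rho> = (\<integral>x. sqrt (p x * q x) \<partial>M)"
  define T where "T = (\<integral>x. \<bar>p x - q x\<bar> \<partial>M) / 2"
  have T0: "0 \<le> T" unfolding T_def by simp
  have \<rho>0: "0 \<le> \<rho>" unfolding \<rho>_def using p0 q0 by (intro integral_nonneg_AE) auto
  have "\<rho> \<le> (\<integral>x. (p x + q x) / 2 \<partial>M)"
    unfolding \<rho>_def using am ir p q by (intro integral_mono) auto
  then have \<rho>1: "\<rho> \<le> 1" using p q by (simp add: p1 q1)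
  \<comment> \<open>Cauchy-Schwarz is obtained from the pointwise inequality
    \<open>2 * l * u * v \<le> l\<^sup>2 * u\<^sup>2 + v\<^sup>2\<close> with a free weight
    \<open>l\<close>, to be optimized after integration.\<close>
  have key: "2 * l * T \<le> l\<^sup>2 * (1 - \<rho>) + (1 + \<rho>)" for l :: real
  proof -
    have pw: "2 * l * \<bar>p x - q x\<bar> \<le> l\<^sup>2 * (p x + q x - 2 * sqrt (p x * q x)) + (p x + q x + 2 * sqrt (p x * q x))" for x
    proof -
      define u v where "u = sqrt (p x)" and "v = sqrt (q x)"
      have uv: "p x = u\<^sup>2" "q x = v\<^sup>2" "sqrt (p x * q x) = u * v" "0 \<le> u" "0 \<le> v"
        using p0 q0 by (auto simp: u_def v_def real_sqrt_mult)
      have "\<bar>p x - q x\<bar> = \<bar>u - v\<bar> * (u + v)"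
        using uv(4,5) by (simp add: uv(1,2) power2_eq_square square_diff_square_factored abs_mult)
      moreover have "0 \<le> (l * \<bar>u - v\<bar> - (u + v))\<^sup>2" by simp
      moreover have "(l * \<bar>u - v\<bar> - (u + v))\<^sup>2 = l\<^sup>2 * (u - v)\<^sup>2 - 2 * l * (\<bar>u - v\<bar> * (u + v)) + (u + v)\<^sup>2"
        by (simp add: power2_diff power_mult_distrib)
      ultimately show ?thesis
        unfolding uv(3) by (simp add: uv(1,2) power2_diff power2_sum mult.assoc)
    qed
    have "(\<integral>x. 2 * l * \<bar>p x - q x\<bar> \<partial>M)
        \<le> (\<integral>x. l\<^sup>2 * (p x + q x - 2 * sqrt (p x * q x)) + (p x + q x + 2 * sqrt (p x * q x)) \<partial>M)"
      using pw ir ia p q by (intro integral_mono) auto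
    also have "\<dots> = l\<^sup>2 * (2 - 2 * \<rho>) + (2 + 2 * \<rho>)"
      using ir p q by (simp add: p1 q1 \<rho>_def)
    finally show ?thesis by (simp add: T_def algebra_simps)
  qed
  have "T\<^sup>2 \<le> (1 - \<rho>) * (1 + \<rho>)"
  \<comment> \<open>The best weight is \<open>T / (1 - \<rho>)\<close>. For \<rho> equal to 1 the
    quadratic term disappears and arbitrarily large weights are allowed: with \<open>T\<close>
    positive, \<open>2 / T\<close> would give \<open>4 \<le> 2\<close>.\<close>
  proof (cases "\<rho> = 1")
    case True
    have "T = 0"
    proof (rule ccontr)
      assume "T \<noteq> 0"
      then have "0 < T" using T0 by simp
      then show False using key[of "2 / T"] True by simp
    qed
    then show ?thesis using True by simp
  next
    case False
    then have "0 < 1 - \<rho>" using \<rho>1 by simp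
    then have "2 * (T * T) \<le> T * T + (1 - \<rho>) * (1 + \<rho>)"
      using key[of "T / (1 - \<rho>)"] mult_left_mono[OF key[of "T / (1 - \<rho>)"], of "1 - \<rho>"]
      by (simp add: power2_eq_square distrib_left)
    then show ?thesis by (simp add: power2_eq_square)
  qed
  then show ?thesis
    unfolding T_def[symmetric] \<rho>_def[symmetric] by (simp add: power2_eq_square algebra_simps)
qed

definition shift_tv :: "(real \<Rightarrow> real) \<Rightarrow> real \<Rightarrow> real" where
  "shift_tv p h = (\<integral>x. \<bar>p x - p (x - h)\<bar> \<partial>lborel) / 2"

lemma integral_shift:
  fixes p :: "real \<Rightarrow> real"
  shows "(\<integral>x. p (x - h) \<partial>lborel) = (\<integral>x. p x \<partial>lborel)"
  using lborel_integral_real_affine[of 1 p "- h"] by simp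

lemma integrable_shift:
  fixes p :: "real \<Rightarrow> real"
  shows "integrable lborel p \<Longrightarrow> integrable lborel (\<lambda>x. p (x - h))"
  using lborel_integrable_real_affine[of p 1 "- h"] by simp

text \<open>At \<open>t = 1/2\<close> the curvature bound makes the geometric mean of
  \<open>p x\<close> and \<open>p (x - h)\<close> at least \<open>exp (- c * h\<^sup>2 / 8)\<close>
  times the density at their midpoint. Squaring the resulting bound on the affinity doubles the
  exponent, and \<open>1 - exp (- u) \<le> u\<close> finishes.\<close>

lemma shift_tv_sq_le:
  fixes \<phi> :: "real \<Rightarrow> real"
  assumes p: "integrable lborel (\<lambda>x. exp (- \<phi> x))" and p1: "(\<integral>x. exp (- \<phi> x) \<partial>lborel) = 1"
    and curv: "\<And>x y t. 0 < t \<Longrightarrow> t < 1 \<Longrightarrow>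
           \<phi> (t * x + (1 - t) * y) - (t * \<phi> x + (1 - t) * \<phi> y)
             \<ge> - (c / 2) * t * (1 - t) * (x - y)\<^sup>2"
  shows "(shift_tv (\<lambda>x. exp (- \<phi> x)) h)\<^sup>2 \<le> min (c * h\<^sup>2 / 4) 1"
proof -
  define \<rho> where "\<rho> = (\<integral>x. sqrt (exp (- \<phi> x) * exp (- \<phi> (x - h))) \<partial>lborel)"
  have [measurable]: "(\<lambda>x. exp (- \<phi> x)) \<in> borel_measurable borel"
    using borel_measurable_integrable[OF p] by simp
  have [measurable]: "(\<lambda>x. exp (- \<phi> (x - h))) \<in> borel_measurable borel"
    by (rule measurable_compose[of "\<lambda>x. x - h" borel borel "\<lambda>x. exp (- \<phi> x)"]) measurable
  have am: "sqrt (exp (- \<phi> x) * exp (- \<phi> (x - h))) \<le> (exp (- \<phi> x) + exp (- \<phi> (x - h))) / 2" for x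
    by (rule arith_geo_mean_sqrt) auto
  have ir: "integrable lborel (\<lambda>x. sqrt (exp (- \<phi> x) * exp (- \<phi> (x - h))))"
    using am by (intro Bochner_Integration.integrable_bound[OF integrable_divide[OF
      Bochner_Integration.integrable_add[OF p integrable_shift[OF p, of h]], of 2]]) auto
  have le: "exp (- \<phi> (x - h / 2)) * exp (- c * h\<^sup>2 / 8) \<le> sqrt (exp (- \<phi> x) * exp (- \<phi> (x - h)))" for x
  proof -
    have "\<phi> (x - h / 2) - (\<phi> x + \<phi> (x - h)) / 2 \<ge> - (c / 8) * h\<^sup>2"
      using curv[of "1/2" x "x - h"] by (simp add: field_simps)
    then have "- \<phi> (x - h / 2) + - c * h\<^sup>2 / 8 \<le> (- \<phi> x + - \<phi> (x - h)) / 2"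
      by (simp add: field_simps)
    moreover have "sqrt (exp (- \<phi> x) * exp (- \<phi> (x - h))) = exp ((- \<phi> x + - \<phi> (x - h)) / 2)"
    proof (rule real_sqrt_unique)
      show "(exp ((- \<phi> x + - \<phi> (x - h)) / 2))\<^sup>2 = exp (- \<phi> x) * exp (- \<phi> (x - h))"
        by (simp flip: exp_double exp_add add: field_simps)
    qed simp
    ultimately show ?thesis by (simp flip: exp_add)
  qed
  \<comment> \<open>The density at the midpoint is the translate by \<open>h / 2\<close>, which has
    mass one.\<close>
  have "exp (- c * h\<^sup>2 / 8) = (\<integral>x. exp (- \<phi> (x - h / 2)) * exp (- c * h\<^sup>2 / 8) \<partial>lborel)"
    using integral_shift[of "\<lambda>x. exp (- \<phi> x)" "h / 2"] integrable_shift[OF p, of "h / 2"] p1 by simp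
  also have "\<dots> \<le> \<rho>"
    unfolding \<rho>_def using le integrable_shift[OF p, of "h / 2"] ir
    by (intro integral_mono) auto
  finally have "exp (- c * h\<^sup>2 / 8) \<le> \<rho>" .
  then have "(exp (- c * h\<^sup>2 / 8))\<^sup>2 \<le> \<rho>\<^sup>2" by (intro power_mono) auto
  moreover have "(exp (- c * h\<^sup>2 / 8))\<^sup>2 = exp (- (c * h\<^sup>2 / 4))"
    by (simp flip: exp_double)
  moreover have "1 - exp (- (c * h\<^sup>2 / 4)) \<le> c * h\<^sup>2 / 4"
    using exp_ge_add_one_self[of "- (c * h\<^sup>2 / 4)"] by simp
  moreover have "(shift_tv (\<lambda>x. exp (- \<phi> x)) h)\<^sup>2 \<le> 1 - \<rho>\<^sup>2"
    unfolding shift_tv_def \<rho>_def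
    using p integrable_shift[OF p, of h] p1 integral_shift[of "\<lambda>x. exp (- \<phi> x)" h]
    by (intro abs_diff_integral_sq_le) auto
  ultimately show ?thesis by (auto simp: min_def intro: order_trans)
qed

section \<open>Contraction by a private kernel in one coordinate\<close>

text \<open>With \<open>K\<close> the kernel of user \<open>i\<close> at coordinate
  \<open>j\<close>, this is the marginal law of the released value when the signal at
  \<open>j\<close> is \<open>t\<close>. No other coordinate of the signal enters it.\<close>

definition local_law :: "real measure \<Rightarrow> real \<Rightarrow> real \<Rightarrow> (real \<Rightarrow> real measure) \<Rightarrow> real measure" where
  "local_law \<nu> \<sigma> t K = \<nu> \<bind> (\<lambda>x. K (t + \<sigma> * x))"

lemma markov_kernel_affine:
  assumes "markov_kernel K" and "sets \<nu> = sets borel"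
  shows "(\<lambda>x. K (t + \<sigma> * x)) \<in> \<nu> \<rightarrow>\<^sub>M prob_algebra borel"
proof -
  have [measurable]: "K \<in> borel \<rightarrow>\<^sub>M prob_algebra borel" using assms(1) by (simp add: markov_kernel_def)
  have "(\<lambda>x. K (t + \<sigma> * x)) \<in> borel \<rightarrow>\<^sub>M prob_algebra borel" by measurable
  then show ?thesis by (simp cong: measurable_cong_sets add: assms(2))
qed

lemma
  assumes "markov_kernel K" and "prob_space \<nu>" "sets \<nu> = sets borel"
  shows prob_space_local_law: "prob_space (local_law \<nu> \<sigma> t K)"
    and sets_local_law: "sets (local_law \<nu> \<sigma> t K) = sets borel"
    and emeasure_local_law: "A \<in> sets borel \<Longrightarrow>
      emeasure (local_law \<nu> \<sigma> t K) A = (\<integral>\<^sup>+x. emeasure (K (t + \<sigma> * x)) A \<partial>\<nu>)"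
proof -
  have \<nu>: "\<nu> \<in> space (prob_algebra borel)" using assms by (simp add: space_prob_algebra)
  have K: "(\<lambda>x. K (t + \<sigma> * x)) \<in> borel \<rightarrow>\<^sub>M prob_algebra borel"
    using markov_kernel_affine[OF assms(1), of borel] by simp
  show "prob_space (local_law \<nu> \<sigma> t K)" unfolding local_law_def by (rule prob_space_bind'[OF \<nu> K])
  show "sets (local_law \<nu> \<sigma> t K) = sets borel" unfolding local_law_def by (rule sets_bind'[OF \<nu> K])
  show "A \<in> sets borel \<Longrightarrow>
      emeasure (local_law \<nu> \<sigma> t K) A = (\<integral>\<^sup>+x. emeasure (K (t + \<sigma> * x)) A \<partial>\<nu>)"
    unfolding local_law_def by (rule emeasure_bind_prob_algebra[OF \<nu> K])
qed

text \<open>For a fixed output event, privacy confines its conditional probability to an interval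
  whose endpoints have ratio \<open>exp \<beta>\<close>. The oscillation is therefore small relative
  to the infimum, and the two input laws enter only through their total variation distance. A bound
  relative to the mass of the event is what controls the likelihood ratio.\<close>

lemma abs_measure_local_law_diff_le:
  fixes p :: "real \<Rightarrow> real"
  assumes K: "markov_kernel K" "diff_private \<beta> K" and \<nu>: "\<nu> = density lborel (\<lambda>x. ennreal (p x))"
    and "prob_space \<nu>" and p[measurable]: "p \<in> borel_measurable borel" and p0: "\<And>x. 0 \<le> p x"
    and \<sigma>: "0 < \<sigma>" and \<beta>: "0 \<le> \<beta>" and A: "A \<in> sets borel"
  shows "\<bar>measure (local_law \<nu> \<sigma> 0 K) A - measure (local_law \<nu> \<sigma> a K) A\<bar>
    \<le> (exp \<beta> - 1) * shift_tv p (a / \<sigma>) * measure (local_law \<nu> \<sigma> a K) A"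
proof -
  interpret \<nu>: prob_space \<nu> by fact
  define h where "h = a / \<sigma>"
  define k where "k x = measure (K (\<sigma> * x)) A" for x
  have sets_\<nu>: "sets \<nu> = sets borel" by (simp add: \<nu>)
  have one: "(\<integral>\<^sup>+x. ennreal (p x) \<partial>lborel) = 1"
    using \<nu>.emeasure_space_1 unfolding \<nu> by (simp add: emeasure_density)
  have ip: "integrable lborel p"
    using one p0 by (intro integrableI_bounded) auto
  have p1: "(\<integral>x. p x \<partial>lborel) = 1"
    using one p0 ip by (subst integral_eq_nn_integral) auto
  have ips: "integrable lborel (\<lambda>x. p (x - h))" "(\<integral>x. p (x - h) \<partial>lborel) = 1"
    using integrable_shift[OF ip] integral_shift[of p h] p1 by auto
  have K': "prob_space (K x)" for x
  proof -
    have "K x \<in> space (prob_algebra borel)"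
      using K(1) unfolding markov_kernel_def by (rule measurable_space) simp
    then show ?thesis by (simp add: space_prob_algebra)
  qed
  have "K \<in> borel \<rightarrow>\<^sub>M subprob_algebra borel"
    using K(1) unfolding markov_kernel_def by (rule measurable_prob_algebraD)
  then have Km: "(\<lambda>x. measure (K x) A) \<in> borel_measurable borel"
    by (rule measurable_compose[OF _ measurable_measure_subprob_algebra[OF A]])
  have k[measurable]: "k \<in> borel_measurable borel"
    unfolding k_def by (rule measurable_compose[OF _ Km]) simp
  have k01: "0 \<le> k x" "k x \<le> 1" for x
    using prob_space.prob_le_1[OF K'] by (auto simp: k_def)
  have dp: "k x \<le> exp \<beta> * k y" for x y
    using K(2) A by (auto simp: diff_private_def k_def)
  have bdd: "bdd_below (range k)" using k01 by (intro bdd_belowI[of _ 0]) auto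
  define m where "m = (INF x. k x)"
  have m_le: "m \<le> k x" for x unfolding m_def using bdd by (rule cINF_lower) simp
  \<comment> \<open>Privacy compares \<open>k x\<close> with every value of \<open>k\<close>, hence
    also with their infimum.\<close>
  have k_le: "k x \<le> exp \<beta> * m" for x
  proof -
    have "k x / exp \<beta> \<le> m"
      unfolding m_def using dp[of x] by (intro cINF_greatest) (auto simp: field_simps)
    then show ?thesis by (simp add: field_simps)
  qed
  \<comment> \<open>Centring \<open>k\<close> at the midpoint of its range \<open>[m, exp \<beta> * m]\<close> costs nothing, both densities having mass 1.\<close>
  define r where "r = (exp \<beta> - 1) * m / 2"
  have kr: "\<bar>k x - (m + r)\<bar> \<le> r" for x
    using m_le[of x] k_le[of x] by (auto simp: r_def abs_le_iff field_simps)
  have ik: "integrable lborel (\<lambda>x. k x * f x)" if "integrable lborel f" for f :: "real \<Rightarrow> real"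
  proof (rule Bochner_Integration.integrable_bound[OF that])
    have "\<bar>k x\<bar> * \<bar>f x\<bar> \<le> 1 * \<bar>f x\<bar>" for x
      using k01[of x] by (intro mult_right_mono) auto
    then show "AE x in lborel. norm (k x * f x) \<le> norm (f x)" by (simp add: abs_mult)
  qed (use that in simp)
  \<comment> \<open>A change of variable moves the signal from the kernel into the density, so that
    a single function \<open>k\<close> serves for all signals.\<close>
  have law: "measure (local_law \<nu> \<sigma> t K) A = (\<integral>x. k x * p (x - t / \<sigma>) \<partial>lborel)" for t
  proof -
    have "emeasure (local_law \<nu> \<sigma> t K) A = (\<integral>\<^sup>+x. ennreal (k (x + t / \<sigma>)) \<partial>\<nu>)"
      using \<sigma> prob_space.emeasure_space_1[OF K'] finite_measure.emeasure_eq_measure[OF prob_space.finite_measure[OF K']]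
      by (simp add: emeasure_local_law[OF K(1) \<open>prob_space \<nu>\<close> sets_\<nu> A] k_def distrib_left add.commute)
    also have "\<dots> = (\<integral>\<^sup>+x. ennreal (k (x + t / \<sigma>) * p x) \<partial>lborel)"
      unfolding \<nu> using p0 k01 by (subst nn_integral_density) (auto simp: ennreal_mult mult.commute)
    also have "\<dots> = (\<integral>\<^sup>+x. ennreal (k x * p (x - t / \<sigma>)) \<partial>lborel)"
      by (subst (2) nn_integral_real_affine[where c=1 and t="t / \<sigma>"]) (auto simp: add.commute)
    also have "\<dots> = ennreal (\<integral>x. k x * p (x - t / \<sigma>) \<partial>lborel)"
      using p0 k01 by (intro nn_integral_eq_integral ik integrable_shift ip) auto
    finally show ?thesis
      using p0 k01 by (simp add: measure_def integral_nonneg_AE)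
  qed
  have law0: "measure (local_law \<nu> \<sigma> 0 K) A = (\<integral>x. k x * p x \<partial>lborel)"
    using law[of 0] by simp
  have lawa: "measure (local_law \<nu> \<sigma> a K) A = (\<integral>x. k x * p (x - h) \<partial>lborel)"
    using law[of a] by (simp add: h_def)
  \<comment> \<open>The infimum is at most any average of \<open>k\<close>; this makes the final
    bound relative to the output probability.\<close>
  have m_le_law: "m \<le> measure (local_law \<nu> \<sigma> a K) A"
  proof -
    have "m = (\<integral>x. m * p (x - h) \<partial>lborel)" using ips by simp
    also have "\<dots> \<le> measure (local_law \<nu> \<sigma> a K) A"
      unfolding lawa using ips ik[OF ips(1)] m_le p0 by (intro integral_mono mult_right_mono) auto
    finally show ?thesis .
  qed
  have idiff: "integrable lborel (\<lambda>x. p x - p (x - h))" using ip ips by simp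
  have "measure (local_law \<nu> \<sigma> 0 K) A - measure (local_law \<nu> \<sigma> a K) A
      = (\<integral>x. (k x - (m + r)) * (p x - p (x - h)) \<partial>lborel)"
  proof -
    have "(\<integral>x. (k x - (m + r)) * (p x - p (x - h)) \<partial>lborel)
        = (\<integral>x. (k x * p x - k x * p (x - h)) - (m + r) * (p x - p (x - h)) \<partial>lborel)"
      by (intro Bochner_Integration.integral_cong) (auto simp: algebra_simps)
    also have "\<dots> = (\<integral>x. k x * p x \<partial>lborel) - (\<integral>x. k x * p (x - h) \<partial>lborel) - (m + r) * (1 - 1)"
      using ik[OF ip] ik[OF ips(1)] idiff ip ips p1 by simp
    finally show ?thesis by (simp add: law0 lawa)
  qed
  also have "\<bar>\<dots>\<bar> \<le> (\<integral>x. r * \<bar>p x - p (x - h)\<bar> \<partial>lborel)"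
  proof (rule integral_abs_bound_integral)
    show "integrable lborel (\<lambda>x. (k x - (m + r)) * (p x - p (x - h)))"
      using ik[OF idiff] idiff by (simp add: left_diff_distrib)
    show "integrable lborel (\<lambda>x. r * \<bar>p x - p (x - h)\<bar>)" using idiff by simp
    show "\<bar>(k x - (m + r)) * (p x - p (x - h))\<bar> \<le> r * \<bar>p x - p (x - h)\<bar>" for x
      unfolding abs_mult by (intro mult_right_mono kr) auto
  qed
  also have "\<dots> = (exp \<beta> - 1) * shift_tv p h * m"
    by (simp add: r_def shift_tv_def)
  also have "\<dots> \<le> (exp \<beta> - 1) * shift_tv p h * measure (local_law \<nu> \<sigma> a K) A"
    using m_le_law \<beta> by (intro mult_left_mono) (auto simp: shift_tv_def)
  finally show ?thesis by (simp add: h_def)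
qed

section \<open>Product kernels and the law of a privatized column\<close>

text \<open>Boxes are stable under intersection and generate the product sigma-algebra, and the
  probability of a box is a finite product of measurable functions.\<close>

lemma measurable_PiM_kernel:
  assumes I: "finite I" and f: "\<And>i. i \<in> I \<Longrightarrow> f i \<in> N \<rightarrow>\<^sub>M prob_algebra (M i)"
  shows "(\<lambda>x. PiM I (\<lambda>i. f i x)) \<in> N \<rightarrow>\<^sub>M prob_algebra (PiM I M)"
proof (rule measurable_prob_algebra_generated[OF _ Int_stable_PiE])
  have f': "prob_space (f i x)" "sets (f i x) = sets (M i)" if "i \<in> I" "x \<in> space N" for i x
    using measurable_space[OF f[OF that(1)] that(2)] by (auto simp: space_prob_algebra)
  show "sets (PiM I M) = sigma_sets (\<Pi>\<^sub>E i\<in>I. space (M i)) {Pi\<^sub>E I E |E. \<forall>i\<in>I. E i \<in> sets (M i)}"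
    unfolding sets_PiM prod_algebra_eq_finite[OF I] by (simp add: Pi_iff)
  show "{Pi\<^sub>E I E |E. \<forall>i\<in>I. E i \<in> sets (M i)} \<subseteq> Pow (\<Pi>\<^sub>E i\<in>I. space (M i))"
  proof
    fix B assume "B \<in> {Pi\<^sub>E I E |E. \<forall>i\<in>I. E i \<in> sets (M i)}"
    then obtain E where B: "B = Pi\<^sub>E I E" and E: "\<And>i. i \<in> I \<Longrightarrow> E i \<in> sets (M i)" by auto
    have "Pi\<^sub>E I E \<subseteq> (\<Pi>\<^sub>E i\<in>I. space (M i))"
      by (rule PiE_mono) (rule sets.sets_into_space[OF E])
    then show "B \<in> Pow (\<Pi>\<^sub>E i\<in>I. space (M i))" using B by simp
  qed
  show "prob_space (PiM I (\<lambda>i. f i x))" if "x \<in> space N" for x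
    using f' that by (intro prob_space_PiM) auto
  show "sets (PiM I (\<lambda>i. f i x)) = sets (PiM I M)" if "x \<in> space N" for x
    using f' that by (intro sets_PiM_cong) auto
  fix B assume "B \<in> {Pi\<^sub>E I E |E. \<forall>i\<in>I. E i \<in> sets (M i)}"
  then obtain E where B: "B = Pi\<^sub>E I E" "\<And>i. i \<in> I \<Longrightarrow> E i \<in> sets (M i)" by auto
  have "(\<lambda>x. \<Prod>i\<in>I. emeasure (f i x) (E i)) \<in> borel_measurable N"
    using measurable_emeasure_subprob_algebra[OF B(2)] measurable_prob_algebraD[OF f]
    by (intro borel_measurable_prod_ennreal) (auto intro: measurable_compose)
  also have "?this \<longleftrightarrow> (\<lambda>x. emeasure (PiM I (\<lambda>i. f i x)) B) \<in> borel_measurable N"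
    unfolding B(1) using f' B(2) by (intro measurable_cong emeasure_PiM_PiE[symmetric] I) auto
  finally show "(\<lambda>x. emeasure (PiM I (\<lambda>i. f i x)) B) \<in> borel_measurable N" .
qed

lemma measurable_product_kernel:
  assumes "\<And>j. j \<in> {1..d} \<Longrightarrow> markov_kernel (K j)"
  shows "product_kernel d K \<in> vec_space d \<rightarrow>\<^sub>M prob_algebra (vec_space d)"
  unfolding product_kernel_def
proof (rule measurable_PiM_kernel)
  fix j assume "j \<in> {1..d}"
  then show "(\<lambda>x. K j (x j)) \<in> vec_space d \<rightarrow>\<^sub>M prob_algebra borel"
    using assms[of j] unfolding markov_kernel_def by (intro measurable_compose[OF measurable_component_singleton])
qed simp

lemma
  assumes "prob_space \<nu>" "sets \<nu> = sets borel"
  shows prob_space_obs_law: "prob_space (obs_law \<nu> \<sigma> d \<theta>)"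
    and sets_obs_law: "sets (obs_law \<nu> \<sigma> d \<theta>) = sets (vec_space d)"
    and nn_integral_obs_law_component: "\<And>f j. f \<in> borel_measurable borel \<Longrightarrow> j \<in> {1..d} \<Longrightarrow>
      (\<integral>\<^sup>+x. f (x j) \<partial>obs_law \<nu> \<sigma> d \<theta>) = (\<integral>\<^sup>+x. f (\<theta> j + \<sigma> * x) \<partial>\<nu>)"
proof -
  interpret prob_space "PiM {1..d} (\<lambda>_. \<nu>)" using assms by (intro prob_space_PiM)
  have [measurable_cong]: "sets \<nu> = sets borel" by fact
  have m[measurable]: "(\<lambda>\<xi>. \<lambda>j\<in>{1..d}. \<theta> j + \<sigma> * \<xi> j) \<in> PiM {1..d} (\<lambda>_. \<nu>) \<rightarrow>\<^sub>M vec_space d"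
    by measurable
  show "prob_space (obs_law \<nu> \<sigma> d \<theta>)" unfolding obs_law_def by (rule prob_space_distr[OF m])
  show "sets (obs_law \<nu> \<sigma> d \<theta>) = sets (vec_space d)" by (simp add: obs_law_def)
  fix f :: "real \<Rightarrow> ennreal" and j assume [measurable]: "f \<in> borel_measurable borel" and j: "j \<in> {1..d}"
  have "(\<integral>\<^sup>+x. f (x j) \<partial>obs_law \<nu> \<sigma> d \<theta>) = (\<integral>\<^sup>+\<xi>. f (\<theta> j + \<sigma> * \<xi> j) \<partial>PiM {1..d} (\<lambda>_. \<nu>))"
    unfolding obs_law_def using j by (subst nn_integral_distr) (auto simp del: atLeastAtMost_iff)
  also have "\<dots> = (\<integral>\<^sup>+x. f (\<theta> j + \<sigma> * x) \<partial>distr (PiM {1..d} (\<lambda>_. \<nu>)) \<nu> (\<lambda>\<xi>. \<xi> j))"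
    using j by (subst nn_integral_distr) (auto simp del: atLeastAtMost_iff)
  also have "distr (PiM {1..d} (\<lambda>_. \<nu>)) \<nu> (\<lambda>\<xi>. \<xi> j) = \<nu>"
    using distr_PiM_component[of "{1..d}" "\<lambda>_. \<nu>" j] assms j by simp
  finally show "(\<integral>\<^sup>+x. f (x j) \<partial>obs_law \<nu> \<sigma> d \<theta>) = (\<integral>\<^sup>+x. f (\<theta> j + \<sigma> * x) \<partial>\<nu>)" .
qed

definition column :: "nat \<Rightarrow> nat \<Rightarrow> (nat \<Rightarrow> nat \<Rightarrow> real) \<Rightarrow> nat \<Rightarrow> real" where
  "column n j z = (\<lambda>i\<in>{1..n}. z i j)"

lemma measurable_column:
  assumes "j \<in> {1..d}"
  shows "column n j \<in> sample_space n d \<rightarrow>\<^sub>M PiM {1..n} (\<lambda>_. borel)"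
  unfolding column_def
proof (rule measurable_restrict)
  fix i assume "i \<in> {1..n}"
  then show "(\<lambda>z. z i j) \<in> sample_space n d \<rightarrow>\<^sub>M borel"
    using assms by (intro measurable_compose[OF measurable_component_singleton[of i]]) auto
qed

text \<open>For the column law, both sides are compared on boxes. Given the data, the probability of
  an event about column \<open>j\<close> is a product over \<open>i\<close> of kernel probabilities
  depending only on \<open>x i j\<close>; integrating over independent users then factorizes and
  leaves the marginal laws.\<close>

lemma
  assumes \<nu>: "prob_space \<nu>" "sets \<nu> = sets borel"
    and Q: "\<And>i. i \<in> {1..n} \<Longrightarrow> Q i = product_kernel d (K i)"
    and K: "\<And>i j. i \<in> {1..n} \<Longrightarrow> j \<in> {1..d} \<Longrightarrow> markov_kernel (K i j)"
  shows prob_space_private_law: "prob_space (private_law n Q (obs_law \<nu> \<sigma> d \<theta>))"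
    and sets_private_law: "sets (private_law n Q (obs_law \<nu> \<sigma> d \<theta>)) = sets (sample_space n d)"
    and distr_private_law_column: "j \<in> {1..d} \<Longrightarrow>
      distr (private_law n Q (obs_law \<nu> \<sigma> d \<theta>)) (PiM {1..n} (\<lambda>_. borel)) (column n j)
        = PiM {1..n} (\<lambda>i. local_law \<nu> \<sigma> (\<theta> j) (K i j))"
proof -
  let ?P = "obs_law \<nu> \<sigma> d \<theta>"
  let ?R = "private_law n Q ?P"
  have P: "prob_space ?P" "sets ?P = sets (vec_space d)"
    using prob_space_obs_law[OF \<nu>] sets_obs_law[OF \<nu>] by auto
  have Qm: "Q i \<in> vec_space d \<rightarrow>\<^sub>M prob_algebra (vec_space d)" if "i \<in> {1..n}" for i
    unfolding Q[OF that] by (intro measurable_product_kernel K that)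
  have Pn: "PiM {1..n} (\<lambda>_. ?P) \<in> space (prob_algebra (sample_space n d))"
    using P by (auto simp: space_prob_algebra intro!: prob_space_PiM sets_PiM_cong)
  have Qn: "(\<lambda>x. PiM {1..n} (\<lambda>i. Q i (x i))) \<in> sample_space n d \<rightarrow>\<^sub>M prob_algebra (sample_space n d)"
  proof (rule measurable_PiM_kernel)
    show "(\<lambda>x. Q i (x i)) \<in> sample_space n d \<rightarrow>\<^sub>M prob_algebra (vec_space d)" if "i \<in> {1..n}" for i
      using Qm that by (intro measurable_compose[OF measurable_component_singleton])
  qed simp
  show pR: "prob_space ?R" unfolding private_law_def by (rule prob_space_bind'[OF Pn Qn])
  show sR: "sets ?R = sets (sample_space n d)" unfolding private_law_def by (rule sets_bind'[OF Pn Qn])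
  assume j: "j \<in> {1..d}"
  have col: "column n j \<in> ?R \<rightarrow>\<^sub>M PiM {1..n} (\<lambda>_. borel)"
    using measurable_column[OF j] by (simp cong: measurable_cong_sets add: sR)
  show "distr ?R (PiM {1..n} (\<lambda>_. borel)) (column n j) = PiM {1..n} (\<lambda>i. local_law \<nu> \<sigma> (\<theta> j) (K i j))"
  proof (rule PiM_eqI_prob_space)
    show "prob_space (local_law \<nu> \<sigma> (\<theta> j) (K i j))" if "i \<in> {1..n}" for i
      using prob_space_local_law[OF K[OF that j] \<nu>] .
    show "sets (distr ?R (PiM {1..n} (\<lambda>_. borel)) (column n j))
        = sets (PiM {1..n} (\<lambda>i. local_law \<nu> \<sigma> (\<theta> j) (K i j)))"
      unfolding sets_distr by (intro sets_PiM_cong refl sets_local_law[OF K[OF _ j] \<nu>, symmetric])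
    fix A assume "\<And>i. i \<in> {1..n} \<Longrightarrow> A i \<in> sets (local_law \<nu> \<sigma> (\<theta> j) (K i j))"
    then have A: "A i \<in> sets borel" if "i \<in> {1..n}" for i
      using that sets_local_law[OF K[OF that j] \<nu>] by blast
    \<comment> \<open>\<open>B i\<close> lifts \<open>A i\<close> to whole vectors, leaving every
      coordinate except \<open>j\<close> free; the free coordinates later contribute factors 1, the
      kernels being Markov.\<close>
    define B where "B = (\<lambda>i. Pi\<^sub>E {1..d} (\<lambda>k. if k = j then A i else UNIV))"
    have B: "B i \<in> sets (vec_space d)" if "i \<in> {1..n}" for i
      unfolding B_def using A[OF that] by (intro sets_PiM_I_finite) auto
    have vimage: "column n j -` Pi\<^sub>E {1..n} A \<inter> space ?R = Pi\<^sub>E {1..n} B"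
      using j unfolding sets_eq_imp_space_eq[OF sR]
      by (auto simp: column_def B_def space_PiM PiE_iff extensional_def split: if_splits)
    have QB: "emeasure (Q i y) (B i) = emeasure (K i j (y j)) (A i)" if i: "i \<in> {1..n}" for i y
    proof -
      have Kp: "prob_space (K i k x)" "sets (K i k x) = sets borel" if "k \<in> {1..d}" for k x
        using measurable_space[OF K[OF i that, unfolded markov_kernel_def], of x]
        by (auto simp: space_prob_algebra)
      have K1: "emeasure (K i k x) UNIV = 1" if "k \<in> {1..d}" for k x
        using prob_space.emeasure_space_1[OF Kp(1)[OF that]] sets_eq_imp_space_eq[OF Kp(2)[OF that]]
        by simp
      have "emeasure (Q i y) (B i) = (\<Prod>k\<in>{1..d}. emeasure (K i k (y k)) (if k = j then A i else UNIV))"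
        unfolding Q[OF i] product_kernel_def B_def
        by (rule emeasure_PiM_PiE) (use Kp A[OF i] in auto)
      also have "\<dots> = (\<Prod>k\<in>{1..d}. if k = j then emeasure (K i j (y j)) (A i) else 1)"
        using K1 by (intro prod.cong) auto
      also have "\<dots> = emeasure (K i j (y j)) (A i)" using j by simp
      finally show ?thesis .
    qed
    have KA: "(\<lambda>x. emeasure (K i j x) (A i)) \<in> borel_measurable borel" if "i \<in> {1..n}" for i
      using measurable_compose[OF measurable_prob_algebraD[OF K[OF that j, unfolded markov_kernel_def]]
        measurable_emeasure_subprob_algebra[OF A[OF that]]] .
    have "emeasure (distr ?R (PiM {1..n} (\<lambda>_. borel)) (column n j)) (Pi\<^sub>E {1..n} A) = emeasure ?R (Pi\<^sub>E {1..n} B)"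
      using emeasure_distr[OF col, of "Pi\<^sub>E {1..n} A"] A unfolding vimage by (simp add: sets_PiM_I_finite)
    also have "\<dots> = (\<integral>\<^sup>+x. emeasure (PiM {1..n} (\<lambda>i. Q i (x i))) (Pi\<^sub>E {1..n} B) \<partial>PiM {1..n} (\<lambda>_. ?P))"
      unfolding private_law_def using B by (intro emeasure_bind_prob_algebra[OF Pn Qn]) auto
    also have "\<dots> = (\<integral>\<^sup>+x. (\<Prod>i\<in>{1..n}. emeasure (K i j (x i j)) (A i)) \<partial>PiM {1..n} (\<lambda>_. ?P))"
    proof (rule nn_integral_cong)
      fix x assume "x \<in> space (PiM {1..n} (\<lambda>_. ?P))"
      then have x: "x i \<in> space (vec_space d)" if "i \<in> {1..n}" for i
        using that sets_eq_imp_space_eq[OF P(2)] by (auto simp: space_PiM PiE_iff)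
      have Qx: "prob_space (Q i (x i))" "sets (Q i (x i)) = sets (vec_space d)" if "i \<in> {1..n}" for i
        using measurable_space[OF Qm[OF that] x[OF that]] by (auto simp: space_prob_algebra)
      have "emeasure (PiM {1..n} (\<lambda>i. Q i (x i))) (Pi\<^sub>E {1..n} B) = (\<Prod>i\<in>{1..n}. emeasure (Q i (x i)) (B i))"
        by (rule emeasure_PiM_PiE) (use Qx B in auto)
      also have "\<dots> = (\<Prod>i\<in>{1..n}. emeasure (K i j (x i j)) (A i))"
        by (rule prod.cong[OF refl QB])
      finally show "emeasure (PiM {1..n} (\<lambda>i. Q i (x i))) (Pi\<^sub>E {1..n} B)
          = (\<Prod>i\<in>{1..n}. emeasure (K i j (x i j)) (A i))" .
    qed
    also have "\<dots> = (\<Prod>i\<in>{1..n}. \<integral>\<^sup>+x. emeasure (K i j (x j)) (A i) \<partial>?P)"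
    proof (rule nn_integral_PiM_prod)
      fix i assume i: "i \<in> {1..n}"
      have "(\<lambda>x. emeasure (K i j (x j)) (A i)) \<in> borel_measurable (vec_space d)"
        by (rule measurable_compose[OF measurable_component_singleton[OF j] KA[OF i]])
      then show "(\<lambda>x. emeasure (K i j (x j)) (A i)) \<in> borel_measurable ?P"
        by (simp cong: measurable_cong_sets add: P(2))
    qed (use P in auto)
    also have "\<dots> = (\<Prod>i\<in>{1..n}. emeasure (local_law \<nu> \<sigma> (\<theta> j) (K i j)) (A i))"
      using nn_integral_obs_law_component[OF \<nu> KA j] emeasure_local_law[OF K[OF _ j] \<nu> A]
      by (intro prod.cong) auto
    finally show "emeasure (distr ?R (PiM {1..n} (\<lambda>_. borel)) (column n j)) (Pi\<^sub>E {1..n} A)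
        = (\<Prod>i\<in>{1..n}. emeasure (local_law \<nu> \<sigma> (\<theta> j) (K i j)) (A i))" .
  qed simp
qed

section \<open>The Bayesian test in a single coordinate\<close>

text \<open>The alternative \<open>F\<close> (signal \<open>a\<close>) is the reference measure and
  \<open>L\<close> the density of the null law \<open>G\<close>; \<open>A\<close> is the event that
  a signal is declared. Contraction, tensorization and the translation bound are combined here, and
  \<open>1 + \<tau>\<^sup>2 \<le> exp (\<tau>\<^sup>2)\<close> turns the power into an
  exponential.\<close>

lemma coordinate_bayes_error_ge:
  assumes \<nu>: "prob_space \<nu>" and \<phi>: "\<nu> = density lborel (\<lambda>x. ennreal (exp (- \<phi> x)))" "\<phi> \<in> borel_measurable borel"
    and curv: "\<And>x y t. 0 < t \<Longrightarrow> t < 1 \<Longrightarrow>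
           \<phi> (t * x + (1 - t) * y) - (t * \<phi> x + (1 - t) * \<phi> y)
             \<ge> - (c / 2) * t * (1 - t) * (x - y)\<^sup>2"
    and \<sigma>: "0 < \<sigma>" and \<beta>: "0 \<le> \<beta>" and I: "finite I"
    and K: "\<And>i. i \<in> I \<Longrightarrow> markov_kernel (K i)" "\<And>i. i \<in> I \<Longrightarrow> diff_private \<beta> (K i)"
    and \<pi>: "0 \<le> \<pi>" "\<pi> \<le> 1" and A: "A \<in> sets (PiM I (\<lambda>_. borel))"
  shows "\<pi> * (1 - \<pi>) * exp (- real (card I) * (exp \<beta> - 1)\<^sup>2 * min (c * a\<^sup>2 / (4 * \<sigma>\<^sup>2)) 1)
    \<le> \<pi> * measure (PiM I (\<lambda>i. local_law \<nu> \<sigma> a (K i))) (space (PiM I (\<lambda>_. borel)) - A)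
      + (1 - \<pi>) * measure (PiM I (\<lambda>i. local_law \<nu> \<sigma> 0 (K i))) A"
proof -
  define F where "F i = local_law \<nu> \<sigma> a (K i)" for i
  define G where "G i = local_law \<nu> \<sigma> 0 (K i)" for i
  define p where "p = (\<lambda>x. exp (- \<phi> x))"
  define \<tau> where "\<tau> = (exp \<beta> - 1) * shift_tv p (a / \<sigma>)"
  note [measurable] = \<phi>(2)
  interpret \<nu>: prob_space \<nu> by fact
  have sets_\<nu>: "sets \<nu> = sets borel" by (simp add: \<phi>)
  have p: "p \<in> borel_measurable borel" "\<And>x. 0 \<le> p x" by (auto simp: p_def)
  have one: "(\<integral>\<^sup>+x. ennreal (p x) \<partial>lborel) = 1"
    using \<nu>.emeasure_space_1 unfolding \<phi> p_def by (simp add: emeasure_density)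
  have ip: "integrable lborel p"
    using one p by (intro integrableI_bounded) auto
  have p1: "(\<integral>x. p x \<partial>lborel) = 1"
    using one p ip by (subst integral_eq_nn_integral) auto
  have \<tau>0: "0 \<le> \<tau>" unfolding \<tau>_def using \<beta> by (intro mult_nonneg_nonneg) (auto simp: shift_tv_def)
  have F: "prob_space (F i)" "sets (F i) = sets borel" and G: "prob_space (G i)" "sets (G i) = sets borel"
    if "i \<in> I" for i
    unfolding F_def G_def using prob_space_local_law[OF K(1)[OF that] \<nu> sets_\<nu>]
      sets_local_law[OF K(1)[OF that] \<nu> sets_\<nu>] by auto
  have le: "\<bar>measure (G i) B - measure (F i) B\<bar> \<le> \<tau> * measure (F i) B" if "i \<in> I" "B \<in> sets (F i)" for i B
    unfolding F_def G_def \<tau>_def using that F p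
    by (intro abs_measure_local_law_diff_le K \<nu> \<sigma> \<beta>) (auto simp: \<phi>(1) p_def)
  obtain L where L: "L \<in> borel_measurable (PiM I F)" "\<And>x. 0 \<le> L x"
    "PiM I G = density (PiM I F) (\<lambda>x. ennreal (L x))"
    "(\<integral>\<^sup>+x. ennreal ((L x)\<^sup>2) \<partial>PiM I F) \<le> ennreal ((1 + \<tau>\<^sup>2) ^ card I)"
    by (rule density_product_second_moment_le[OF I F(1) G(1) _ \<tau>0 le]) (use F G in auto)
  have sF: "sets (PiM I F) = sets (PiM I (\<lambda>_. borel))" using F by (intro sets_PiM_cong) auto
  have "\<pi> * (1 - \<pi>) / (1 + \<tau>\<^sup>2) ^ card I \<le> \<pi> * measure (PiM I F) (space (PiM I F) - A)
      + (1 - \<pi>) * measure (density (PiM I F) (\<lambda>x. ennreal (L x))) A"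
  proof (rule bayes_error_ge_second_moment[OF _ L(1,2) _ L(4) _ \<pi>])
    show "prob_space (PiM I F)" using F by (intro prob_space_PiM) auto
    show "prob_space (density (PiM I F) (\<lambda>x. ennreal (L x)))"
      unfolding L(3)[symmetric] using G by (intro prob_space_PiM) auto
    show "1 \<le> (1 + \<tau>\<^sup>2) ^ card I" by (intro one_le_power) simp
    show "A \<in> sets (PiM I F)" using A sF by simp
  qed
  moreover have "\<pi> * (1 - \<pi>) * exp (- real (card I) * (exp \<beta> - 1)\<^sup>2 * min (c * a\<^sup>2 / (4 * \<sigma>\<^sup>2)) 1)
      \<le> \<pi> * (1 - \<pi>) / (1 + \<tau>\<^sup>2) ^ card I"
  proof -
    have "(shift_tv p (a / \<sigma>))\<^sup>2 \<le> min (c * (a / \<sigma>)\<^sup>2 / 4) 1"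
      unfolding p_def using ip p1 curv by (intro shift_tv_sq_le) (auto simp: p_def)
    then have "\<tau>\<^sup>2 \<le> (exp \<beta> - 1)\<^sup>2 * min (c * a\<^sup>2 / (4 * \<sigma>\<^sup>2)) 1"
      unfolding \<tau>_def power_mult_distrib by (intro mult_left_mono) (simp_all add: power_divide mult.commute)
    then have "real (card I) * \<tau>\<^sup>2 \<le> real (card I) * ((exp \<beta> - 1)\<^sup>2 * min (c * a\<^sup>2 / (4 * \<sigma>\<^sup>2)) 1)"
      by (rule mult_left_mono) simp
    then have "exp (- real (card I) * (exp \<beta> - 1)\<^sup>2 * min (c * a\<^sup>2 / (4 * \<sigma>\<^sup>2)) 1) \<le> exp (- (real (card I) * \<tau>\<^sup>2))"
      by (simp add: mult.assoc)
    also have "\<dots> = 1 / exp (\<tau>\<^sup>2) ^ card I"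
      by (simp add: exp_minus exp_of_nat_mult inverse_eq_divide)
    also have "\<dots> \<le> 1 / (1 + \<tau>\<^sup>2) ^ card I"
      by (intro divide_left_mono power_mono mult_pos_pos zero_less_power) (auto intro: add_pos_nonneg)
    finally have "\<pi> * (1 - \<pi>) * exp (- real (card I) * (exp \<beta> - 1)\<^sup>2 * min (c * a\<^sup>2 / (4 * \<sigma>\<^sup>2)) 1)
        \<le> \<pi> * (1 - \<pi>) * (1 / (1 + \<tau>\<^sup>2) ^ card I)"
      using \<pi> by (intro mult_left_mono) auto
    then show ?thesis by simp
  qed
  ultimately show ?thesis
    unfolding L(3)[symmetric] F_def[symmetric] G_def[symmetric]
    using sets_eq_imp_space_eq[OF sF] by simp
qed

section \<open>Separable selectors as families of column tests\<close>

text \<open>A separable selector factors through the column: test it on the sample all of whose columns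
  equal the given one.\<close>

definition column_test :: "nat \<Rightarrow> nat \<Rightarrow> ((nat \<Rightarrow> nat \<Rightarrow> real) \<Rightarrow> nat \<Rightarrow> nat) \<Rightarrow> nat \<Rightarrow> (nat \<Rightarrow> real) set" where
  "column_test n d h j = {w \<in> space (PiM {1..n} (\<lambda>_. borel)). h (\<lambda>i\<in>{1..n}. \<lambda>k\<in>{1..d}. w i) j = 1}"

lemma column_test_sets:
  assumes "h \<in> separable_selectors n d"
  shows "column_test n d h j \<in> sets (PiM {1..n} (\<lambda>_. borel))"
proof -
  have h: "h \<in> sample_space n d \<rightarrow>\<^sub>M count_space ({1..d} \<rightarrow>\<^sub>E {0, 1})"
    using assms by (simp add: separable_selectors_def selectors_def)
  have e: "(\<lambda>w. \<lambda>i\<in>{1..n}. \<lambda>k\<in>{1..d}. w i) \<in> PiM {1..n} (\<lambda>_. borel) \<rightarrow>\<^sub>M sample_space n d"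
    by (intro measurable_restrict) auto
  have "(\<lambda>w. h (\<lambda>i\<in>{1..n}. \<lambda>k\<in>{1..d}. w i)) \<in> PiM {1..n} (\<lambda>_. borel) \<rightarrow>\<^sub>M count_space ({1..d} \<rightarrow>\<^sub>E {0, 1})"
    by (rule measurable_compose[OF e h])
  then have "(\<lambda>w. h (\<lambda>i\<in>{1..n}. \<lambda>k\<in>{1..d}. w i)) -` {v \<in> {1..d} \<rightarrow>\<^sub>E {0, 1}. v j = 1}
      \<inter> space (PiM {1..n} (\<lambda>_. borel)) \<in> sets (PiM {1..n} (\<lambda>_. borel))"
    by (rule measurable_sets) auto
  also have "(\<lambda>w. h (\<lambda>i\<in>{1..n}. \<lambda>k\<in>{1..d}. w i)) -` {v \<in> {1..d} \<rightarrow>\<^sub>E {0, 1}. v j = 1}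
      \<inter> space (PiM {1..n} (\<lambda>_. borel)) = column_test n d h j"
    using measurable_space[OF measurable_compose[OF e h], unfolded space_count_space]
    unfolding column_test_def by blast
  finally show ?thesis .
qed

lemma column_in_column_test_iff:
  assumes h: "h \<in> separable_selectors n d" and j: "j \<in> {1..d}" and z: "z \<in> space (sample_space n d)"
  shows "column n j z \<in> column_test n d h j \<longleftrightarrow> h z j = 1"
proof -
  let ?z = "\<lambda>i\<in>{1..n}. \<lambda>k\<in>{1..d}. column n j z i"
  have "?z \<in> space (sample_space n d)" by (auto simp: space_PiM)
  moreover have "\<forall>i\<in>{1..n}. ?z i j = z i j" using j by (auto simp: column_def)
  ultimately have "h ?z j = h z j"
    using h j z unfolding separable_selectors_def by blast
  moreover have "column n j z \<in> space (PiM {1..n} (\<lambda>_. borel))"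
    by (rule measurable_space[OF measurable_column[OF j] z])
  ultimately show ?thesis by (simp add: column_test_def)
qed

text \<open>The loss is a sum of coordinate errors, so by linearity only the law of each column
  enters. An error at \<open>j\<close> is a false alarm if \<open>\<theta> j = 0\<close> and a miss
  otherwise, and either one is an event about the column.\<close>

lemma expected_hamming_private_law:
  assumes \<nu>: "prob_space \<nu>" "sets \<nu> = sets borel"
    and Q: "\<And>i. i \<in> {1..n} \<Longrightarrow> Q i = product_kernel d (K i)"
    and K: "\<And>i j. i \<in> {1..n} \<Longrightarrow> j \<in> {1..d} \<Longrightarrow> markov_kernel (K i j)"
    and h: "h \<in> separable_selectors n d"
  shows "(\<integral>\<^sup>+z. ennreal (hamming d (h z) (support_vec d \<theta>)) \<partial>private_law n Q (obs_law \<nu> \<sigma> d \<theta>))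
    = ennreal (\<Sum>j = 1..d. measure (PiM {1..n} (\<lambda>i. local_law \<nu> \<sigma> (\<theta> j) (K i j)))
        (if \<theta> j = 0 then column_test n d h j
         else space (PiM {1..n} (\<lambda>_. borel)) - column_test n d h j))"
proof -
  let ?R = "private_law n Q (obs_law \<nu> \<sigma> d \<theta>)"
  define B where "B j = (if \<theta> j = 0 then column_test n d h j
    else space (PiM {1..n} (\<lambda>_. borel)) - column_test n d h j)" for j
  interpret R: prob_space ?R using prob_space_private_law[OF \<nu> Q K] .
  have sR: "sets ?R = sets (sample_space n d)" using sets_private_law[OF \<nu> Q K] .
  have col: "column n j \<in> ?R \<rightarrow>\<^sub>M PiM {1..n} (\<lambda>_. borel)" if "j \<in> {1..d}" for j
    using measurable_column[OF that] by (simp cong: measurable_cong_sets add: sR)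
  have B: "B j \<in> sets (PiM {1..n} (\<lambda>_. borel))" for j
    unfolding B_def using column_test_sets[OF h] by auto
  have hm: "h \<in> sample_space n d \<rightarrow>\<^sub>M count_space ({1..d} \<rightarrow>\<^sub>E {0, 1})"
    using h by (simp add: separable_selectors_def selectors_def)
  \<comment> \<open>With only the values 0 and 1 possible, a miss is exactly the complement of the
    event tested by \<open>column_test\<close>.\<close>
  have h01: "h z j = 0 \<or> h z j = 1" if "z \<in> space (sample_space n d)" "j \<in> {1..d}" for z j
    using PiE_mem[OF measurable_space[OF hm that(1), unfolded space_count_space] that(2)] by simp
  have ind: "(if h z j \<noteq> support_vec d \<theta> j then 1 else 0) = (indicator (column n j -` B j \<inter> space ?R) z :: real)"
    if z: "z \<in> space ?R" and j: "j \<in> {1..d}" for z j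
  proof -
    have z': "z \<in> space (sample_space n d)" using z sets_eq_imp_space_eq[OF sR] by simp
    have "h z j = 0 \<or> h z j = 1" by (rule h01[OF z' j])
    moreover have "column n j z \<in> space (PiM {1..n} (\<lambda>_. borel))"
      by (rule measurable_space[OF measurable_column[OF j] z'])
    ultimately show ?thesis
      using column_in_column_test_iff[OF h j z'] z j by (auto simp: support_vec_def B_def indicator_def)
  qed
  have meas: "column n j -` B j \<inter> space ?R \<in> sets ?R" if "j \<in> {1..d}" for j
    by (rule measurable_sets[OF col[OF that] B])
  have "(\<integral>\<^sup>+z. ennreal (hamming d (h z) (support_vec d \<theta>)) \<partial>?R)
      = (\<integral>\<^sup>+z. (\<Sum>j = 1..d. indicator (column n j -` B j \<inter> space ?R) z) \<partial>?R)"
  proof (rule nn_integral_cong)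
    fix z assume z: "z \<in> space ?R"
    have "hamming d (h z) (support_vec d \<theta>) = (\<Sum>j = 1..d. indicator (column n j -` B j \<inter> space ?R) z)"
      unfolding hamming_def using ind[OF z] by (intro sum.cong) auto
    then show "ennreal (hamming d (h z) (support_vec d \<theta>))
        = (\<Sum>j = 1..d. indicator (column n j -` B j \<inter> space ?R) z)"
      by (simp add: sum_ennreal[symmetric] ennreal_indicator)
  qed
  also have "\<dots> = (\<Sum>j = 1..d. emeasure ?R (column n j -` B j \<inter> space ?R))"
    using meas by (subst nn_integral_sum) (auto intro!: sum.cong)
  also have "\<dots> = (\<Sum>j = 1..d. ennreal (measure (PiM {1..n} (\<lambda>i. local_law \<nu> \<sigma> (\<theta> j) (K i j))) (B j)))"
  proof (rule sum.cong)
    fix j assume j: "j \<in> {1..d}"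
    have "emeasure ?R (column n j -` B j \<inter> space ?R) = emeasure (distr ?R (PiM {1..n} (\<lambda>_. borel)) (column n j)) (B j)"
      by (rule emeasure_distr[OF col[OF j] B, symmetric])
    also have "distr ?R (PiM {1..n} (\<lambda>_. borel)) (column n j) = PiM {1..n} (\<lambda>i. local_law \<nu> \<sigma> (\<theta> j) (K i j))"
      by (rule distr_private_law_column[OF \<nu> Q K j])
    also have "emeasure \<dots> (B j) = ennreal (measure (PiM {1..n} (\<lambda>i. local_law \<nu> \<sigma> (\<theta> j) (K i j))) (B j))"
      by (intro finite_measure.emeasure_eq_measure prob_space.finite_measure prob_space_PiM
          prob_space_local_law[OF K[OF _ j] \<nu>])
    finally show "emeasure ?R (column n j -` B j \<inter> space ?R)
        = ennreal (measure (PiM {1..n} (\<lambda>i. local_law \<nu> \<sigma> (\<theta> j) (K i j))) (B j))" .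
  qed simp
  finally show ?thesis by (simp add: sum_ennreal B_def)
qed

section \<open>From coordinate tests to the minimax risk\<close>

theorem theorem2p1:
  fixes \<nu> :: "real measure" and \<phi> :: "real \<Rightarrow> real"
    and \<sigma> a \<alpha> c :: real and n d s :: nat
  assumes "\<sigma> > 0"
    and "noise_law \<nu>"
    and "\<nu> = density lborel (\<lambda>x. ennreal (exp (- \<phi> x)))"
    and "convex_on UNIV \<phi>"
    and "c > 0"
    and "\<And>x y t. 0 < t \<Longrightarrow> t < 1 \<Longrightarrow>
           \<phi> (t * x + (1 - t) * y) - (t * \<phi> x + (1 - t) * \<phi> y)
             \<ge> - (c / 2) * t * (1 - t) * (x - y)\<^sup>2"
    and "a > 0" and "\<alpha> > 0" and "1 \<le> s" and "s \<le> d" and "1 \<le> n"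
  shows "minimax_risk_CL \<nu> \<sigma> n d s \<alpha> (sparse_class d s a)
    \<ge> ennreal ((1 - real s / real d) *
        exp (- 4 * real n * (exp (\<alpha> / real d) - 1)\<^sup>2 * min (c * a\<^sup>2 / (4 * \<sigma>\<^sup>2)) 1))"
  unfolding minimax_risk_CL_def
proof (intro INF_greatest)
  fix Q h assume "Q \<in> coord_local n d \<alpha>" and h: "h \<in> separable_selectors n d"
  then have "\<forall>i\<in>{1..n}. \<exists>K. Q i = product_kernel d K \<and>
      (\<forall>j\<in>{1..d}. markov_kernel (K j) \<and> diff_private (\<alpha> / real d) (K j))"
    unfolding coord_local_def by blast
  from bchoice[OF this] obtain K where Q: "\<And>i. i \<in> {1..n} \<Longrightarrow> Q i = product_kernel d (K i)"
    and K: "\<And>i j. i \<in> {1..n} \<Longrightarrow> j \<in> {1..d} \<Longrightarrow> markov_kernel (K i j)"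
    and dp: "\<And>i j. i \<in> {1..n} \<Longrightarrow> j \<in> {1..d} \<Longrightarrow> diff_private (\<alpha> / real d) (K i j)"
    by blast
  have \<nu>: "prob_space \<nu>" "sets \<nu> = sets borel" using \<open>noise_law \<nu>\<close> by (auto simp: noise_law_def)
  \<comment> \<open>A finite convex function on the line is Borel measurable; convexity supplies the
    measurability needed to integrate against the density.\<close>
  have \<phi>: "\<phi> \<in> borel_measurable borel"
    using convex_measurable[of "\<lambda>x. x" borel UNIV \<phi>] \<open>convex_on UNIV \<phi>\<close> by simp
  have d: "0 < real d" and s: "0 < real s" using assms by auto
  define \<pi> where "\<pi> = real s / real d"
  have \<pi>: "0 \<le> \<pi>" "\<pi> \<le> 1" using assms d by (auto simp: \<pi>_def)
  define \<kappa> where "\<kappa> = (exp (\<alpha> / real d) - 1)\<^sup>2 * min (c * a\<^sup>2 / (4 * \<sigma>\<^sup>2)) 1"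
  have \<kappa>: "0 \<le> \<kappa>" unfolding \<kappa>_def using assms by simp
  define S\<^sub>0 where "S\<^sub>0 = space (PiM {1..n} (\<lambda>_. borel :: real measure))"
  \<comment> \<open>\<open>f j\<close> is the probability of missing a signal of size
    \<open>a\<close> at \<open>j\<close>, and \<open>g j\<close> below is that of a false alarm
    there.\<close>
  define f where "f j = measure (PiM {1..n} (\<lambda>i. local_law \<nu> \<sigma> a (K i j))) (S\<^sub>0 - column_test n d h j)" for j
  define g where "g j = measure (PiM {1..n} (\<lambda>i. local_law \<nu> \<sigma> 0 (K i j))) (column_test n d h j)" for j
  have bayes: "\<pi> * (1 - \<pi>) * exp (- 4 * real n * \<kappa>) \<le> \<pi> * f j + (1 - \<pi>) * g j" if j: "j \<in> {1..d}" for j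
  proof -
    \<comment> \<open>The single-coordinate bound has the constant 1 in its exponent; it is weakened
      to 4 here, \<open>\<kappa>\<close> being nonnegative.\<close>
    have "real n * \<kappa> \<le> 4 * (real n * \<kappa>)" using \<kappa> by simp
    then have "\<pi> * (1 - \<pi>) * exp (- 4 * real n * \<kappa>) \<le> \<pi> * (1 - \<pi>) * exp (- real n * \<kappa>)"
      using \<pi> by (intro mult_left_mono) auto
    also have "\<dots> \<le> \<pi> * f j + (1 - \<pi>) * g j"
      using coordinate_bayes_error_ge[OF \<nu>(1) assms(3) \<phi> assms(6) \<open>\<sigma> > 0\<close>, of "\<alpha> / real d" "{1..n}" "\<lambda>i. K i j" \<pi>
          "column_test n d h j" a] K[OF _ j] dp[OF _ j] \<pi> column_test_sets[OF h] \<open>\<alpha> > 0\<close>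
      by (simp add: f_def g_def S\<^sub>0_def \<kappa>_def mult.assoc)
    finally show ?thesis .
  qed
  \<comment> \<open>Making \<open>j\<close> a signal changes its error probability by
    \<open>f j - g j\<close>. The support is chosen after \<open>Q\<close> and \<open>h\<close>, so
    it may be the worst one for them.\<close>
  obtain S where S: "S \<subseteq> {1..d}" "card S = s"
    "real s * (\<Sum>j = 1..d. f j - g j) \<le> real d * (\<Sum>j\<in>S. f j - g j)"
    using exists_subset_sum_ge_average[of "{1..d}" s "\<lambda>j. f j - g j"] \<open>s \<le> d\<close> by auto
  define \<theta> where "\<theta> = (\<lambda>j\<in>{1..d}. if j \<in> S then a else 0)"
  have \<theta>: "\<theta> \<in> sparse_class d s a"
    unfolding sparse_class_def using S(1,2)
    by (auto simp: \<theta>_def space_PiM intro!: exI[of _ S])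
  have risk: "(\<integral>\<^sup>+z. ennreal (hamming d (h z) (support_vec d \<theta>)) \<partial>private_law n Q (obs_law \<nu> \<sigma> d \<theta>))
      = ennreal (\<Sum>j = 1..d. measure (PiM {1..n} (\<lambda>i. local_law \<nu> \<sigma> (\<theta> j) (K i j)))
        (if \<theta> j = 0 then column_test n d h j else S\<^sub>0 - column_test n d h j))"
    unfolding S\<^sub>0_def by (rule expected_hamming_private_law[OF \<nu> Q K h])
  have "(1 - \<pi>) * exp (- 4 * real n * \<kappa>) \<le> 1 / real s * (\<Sum>j = 1..d. if j \<in> S then f j else g j)"
  proof -
    \<comment> \<open>Written as \<open>\<pi> * (f j - g j) + g j\<close>, the Bayes errors sum to a
      risk averaged over supports. Since \<pi> is \<open>s / d\<close>, the choice of
      \<open>S\<close> bounds this by the actual sum of errors at \<open>\<theta>\<close>.\<close>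
    have "real d * (\<pi> * (1 - \<pi>) * exp (- 4 * real n * \<kappa>)) \<le> (\<Sum>j = 1..d. \<pi> * f j + (1 - \<pi>) * g j)"
      using sum_bounded_below[of "{1..d}" _ "\<lambda>j. \<pi> * f j + (1 - \<pi>) * g j", OF bayes] by simp
    also have "\<dots> = \<pi> * (\<Sum>j = 1..d. f j - g j) + (\<Sum>j = 1..d. g j)"
      by (simp add: sum.distrib sum_subtractf sum_distrib_left algebra_simps)
    also have "\<pi> * (\<Sum>j = 1..d. f j - g j) \<le> (\<Sum>j\<in>S. f j - g j)"
      using S(3) d by (simp add: \<pi>_def field_simps)
    also have "(\<Sum>j\<in>S. f j - g j) = (\<Sum>j = 1..d. if j \<in> S then f j - g j else 0)"
      using S(1) by (simp add: sum.If_cases Int_absorb1)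
    also have "\<dots> + (\<Sum>j = 1..d. g j) = (\<Sum>j = 1..d. if j \<in> S then f j else g j)"
      unfolding sum.distrib[symmetric] by (intro sum.cong) auto
    finally have "real d * (\<pi> * (1 - \<pi>) * exp (- 4 * real n * \<kappa>)) \<le> (\<Sum>j = 1..d. if j \<in> S then f j else g j)"
      by simp
    \<comment> \<open>The prior weight cancels the normalization of the risk:
      \<open>d * \<pi> = s\<close>.\<close>
    moreover have "real d * (\<pi> * (1 - \<pi>) * exp (- 4 * real n * \<kappa>)) = real s * ((1 - \<pi>) * exp (- 4 * real n * \<kappa>))"
      using d by (simp add: \<pi>_def)
    ultimately show ?thesis using s by (simp add: field_simps)
  qed
  also have "(\<Sum>j = 1..d. if j \<in> S then f j else g j)
      = (\<Sum>j = 1..d. measure (PiM {1..n} (\<lambda>i. local_law \<nu> \<sigma> (\<theta> j) (K i j)))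
        (if \<theta> j = 0 then column_test n d h j else S\<^sub>0 - column_test n d h j))"
    \<comment> \<open>Positivity of \<open>a\<close> makes \<open>S\<close> exactly the set of
      nonzero coordinates of \<open>\<theta>\<close>.\<close>
    using \<open>a > 0\<close> by (intro sum.cong) (auto simp: f_def g_def \<theta>_def)
  finally have "ennreal ((1 - \<pi>) * exp (- 4 * real n * \<kappa>))
      \<le> ennreal (1 / real s) * (\<integral>\<^sup>+z. ennreal (hamming d (h z) (support_vec d \<theta>))
          \<partial>private_law n Q (obs_law \<nu> \<sigma> d \<theta>))"
    unfolding risk by (subst ennreal_mult[symmetric]) (auto intro!: ennreal_leI sum_nonneg)
  also have "\<dots> \<le> (SUP \<theta>\<in>sparse_class d s a. ennreal (1 / real s) *
      (\<integral>\<^sup>+z. ennreal (hamming d (h z) (support_vec d \<theta>)) \<partial>private_law n Q (obs_law \<nu> \<sigma> d \<theta>)))"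
    by (rule SUP_upper[OF \<theta>])
  finally show "ennreal ((1 - real s / real d) *
        exp (- 4 * real n * (exp (\<alpha> / real d) - 1)\<^sup>2 * min (c * a\<^sup>2 / (4 * \<sigma>\<^sup>2)) 1))
      \<le> (SUP \<theta>\<in>sparse_class d s a. ennreal (1 / real s) *
      (\<integral>\<^sup>+z. ennreal (hamming d (h z) (support_vec d \<theta>)) \<partial>private_law n Q (obs_law \<nu> \<sigma> d \<theta>)))"
    by (simp add: \<pi>_def \<kappa>_def mult.assoc)
qed

end
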